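(* Let $\zeta$ be an $\mathbb N_0$-valued random variable (offspring distribution) with $0<\kappa:=\mathbb E\zeta<1$ and $\mathbb E R^\zeta=\infty$ for every $R>1$. Let $\mathcal T_n$ be the conditioned Galton–Watson tree with offspring distribution $\zeta$ and $n$ vertices, and assume that its maximum outdegree satisfies $\Delta(\mathcal T_n)/n\to 1-\kappa$ in probability as $n\to\infty$. Then, as $n\to\infty$, $$\mathcal T_n\to\Upsilon_\nu\quad\text{in probability},$$ where $\nu=\mathrm{Ge}(1-\kappa)$ is the geometric distribution on $\{1,2,\dots\}$ given by $\nu\{\ell\}=(1-\kappa)\kappa^{\ell-1}$, $\ell\ge1$.
   Context: The Galton–Watson tree $\mathcal T$ with offspring distribution $\zeta$ is the (rooted, ordered) family tree of the Galton–Watson process started from one individual; it is a.s. finite since $\mathbb E\zeta<1$. The conditioned Galton–Watson tree $\mathcal T_n$ is $\mathcal T$ conditioned on $|\mathcal T|=n$; only $n$ with $\mathbb P(|\mathcal T|=n)>0$ are considered, and limits as $n\to\infty$ are along such $n$. $\Delta(T)$ is the maximum outdegree (number of children) over vertices of $T$. $M_\infty$ is the Polish space of infinite real matrices $(a_{ij})_{i,j\ge1}$ with the product topology, and $\mathcal P(M_\infty)$ is the space of Borel probability measures on it with the weak topology. For a finite tree $T$, $\tau_\infty(T)\in\mathcal P(M_\infty)$ is the distribution of $(d_T(\xi_i,\xi_j)\mathbf 1\{i\ne j\})_{i,j\ge1}$, where $d_T$ is the (unrescaled) graph distance and $\xi_1,\xi_2,\dots$ are i.i.d. uniformly random vertices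 of $T$. For a probability measure $\nu$ on $[0,\infty)$, $\Upsilon_\nu$ is the long dendron whose base is a one-point real tree and whose measure on $\{\bullet\}\times[0,\infty)\cong[0,\infty)$ is $\nu$; its sampling measure $\tau_\infty(\Upsilon_\nu)$ is the distribution of $((\eta_i+\eta_j)\mathbf 1\{i\neq j\})_{i,j\ge1}$ with $\eta_1,\eta_2,\dots$ i.i.d. with distribution $\nu$. For random trees, "$\mathcal T_n\to\Upsilon_\nu$ in probability" means that the random elements $\tau_\infty(\mathcal T_n)$ of $\mathcal P(M_\infty)$ converge in probability to $\tau_\infty(\Upsilon_\nu)$. *)

theory Defs
  imports "HOL-Probability.Probability"
begin

section \<open>Trees\<close>

text \<open>
  Vertices of rooted ordered trees are Ulam--Harris words: the root is \<open>[]\<close>, and the children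
  of \<open>u\<close>, from left to right, are \<open>u @ [0]\<close>, \<open>u @ [1]\<close>, and so on. A tree is identified with
  its set of vertices.
\<close>

type_synonym utree = "nat list set"

definition tree_edges :: "utree \<Rightarrow> (nat list \<times> nat list) set" where
  "tree_edges T = {(u, v). u \<in> T \<and> v \<in> T \<and> (\<exists>i. v = u @ [i] \<or> u = v @ [i])}"

definition tree_dist :: "utree \<Rightarrow> nat list \<Rightarrow> nat list \<Rightarrow> nat" where
  "tree_dist T u v = (LEAST k. (u, v) \<in> tree_edges T ^^ k)"

definition outdegree :: "utree \<Rightarrow> nat list \<Rightarrow> nat" where
  "outdegree T u = card {v \<in> T. \<exists>i. v = u @ [i]}"

definition max_outdegree :: "utree \<Rightarrow> nat" where
  "max_outdegree T = Max (outdegree T ` T)"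

section \<open>Galton--Watson trees\<close>

text \<open>
  \<open>c u\<close> is the number of children that the individual \<open>u\<close> has if it is ever born.
\<close>

inductive_set family_tree :: "(nat list \<Rightarrow> nat) \<Rightarrow> utree" for c where
  root: "[] \<in> family_tree c"
| child: "u \<in> family_tree c \<Longrightarrow> i < c u \<Longrightarrow> u @ [i] \<in> family_tree c"

definition offspring_space :: "nat pmf \<Rightarrow> (nat list \<Rightarrow> nat) measure" where
  "offspring_space \<zeta> = (\<Pi>\<^sub>M u\<in>UNIV. measure_pmf \<zeta>)"

definition size_event :: "nat \<Rightarrow> (nat list \<Rightarrow> nat) set" where
  "size_event n = {c. finite (family_tree c) \<and> card (family_tree c) = n}"

text \<open>
  The law of the family tree given that it has \<open>n\<close> vertices. The probability space is cut down
  to the conditioning event because there the family tree takes only countably many values, so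
  that it is measurable with respect to the discrete sigma-algebra. The definition is meaningful
  only if the conditioning event has positive probability.
\<close>

definition conditioned_GW :: "nat pmf \<Rightarrow> nat \<Rightarrow> utree measure" where
  "conditioned_GW \<zeta> n =
     distr (restrict_space (uniform_measure (offspring_space \<zeta>) (size_event n)) (size_event n))
       (count_space UNIV) family_tree"

text \<open>The limit \<open>n \<rightarrow> \<infinity>\<close> along those \<open>n\<close> for which the conditioning makes sense.\<close>

definition GW_sizes :: "nat pmf \<Rightarrow> nat filter" where
  "GW_sizes \<zeta> =
     inf sequentially (principal {n. measure (offspring_space \<zeta>) (size_event n) > 0})"

section \<open>Weak topology and convergence in probability\<close>

definition weak_topology :: "'a::topological_space measure topology" where
  "weak_topology = topology_generated_by
     {{\<mu>. prob_space \<mu> \<and> sets \<mu> = sets borel \<and> (\<integral>x. f x \<partial>\<mu>) \<in> V} | f (V :: real set).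
        continuous_on UNIV f \<and> bounded (range f) \<and> open V}"

text \<open>
  Convergence in probability to a constant \<open>l\<close> of random elements \<open>X n\<close>, each defined on its own
  probability space \<open>\<Omega> n\<close>. If the topology is metrizable, this is the usual definition
  \<open>P (d (X n) l > \<epsilon>) \<longlonglongrightarrow> 0\<close> for every \<open>\<epsilon> > 0\<close>, whichever metric \<open>d\<close> is used.
\<close>

definition converges_in_prob ::
  "'b topology \<Rightarrow> (nat \<Rightarrow> 'a measure) \<Rightarrow> (nat \<Rightarrow> 'a \<Rightarrow> 'b) \<Rightarrow> 'b \<Rightarrow> nat filter \<Rightarrow> bool" where
  "converges_in_prob S \<Omega> X l F \<longleftrightarrow>
     l \<in> topspace S \<and>
     (\<forall>U. openin S U \<and> l \<in> U \<longrightarrow>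
        ((\<lambda>n. measure (\<Omega> n) {\<omega> \<in> space (\<Omega> n). X n \<omega> \<in> U}) \<longlongrightarrow> 1) F)"

section \<open>Sampling measures\<close>

text \<open>
  Infinite real matrices are functions \<^typ>\<open>nat \<Rightarrow> nat \<Rightarrow> real\<close>, with rows and columns indexed
  from 0; the topology on this type is the product topology.
\<close>

definition tau_tree :: "utree \<Rightarrow> (nat \<Rightarrow> nat \<Rightarrow> real) measure" where
  "tau_tree T =
     distr (\<Pi>\<^sub>M i\<in>(UNIV :: nat set). measure_pmf (pmf_of_set T)) borel
       (\<lambda>\<xi> i j. if i \<noteq> j then real (tree_dist T (\<xi> i) (\<xi> j)) else 0)"

text \<open>
  The sampling measure of the long dendron \<open>\<Upsilon>\<^sub>\<nu>\<close>: since its base is a single point, two sampled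
  points of heights \<open>\<eta>\<^sub>i\<close> and \<open>\<eta>\<^sub>j\<close> are at distance \<open>\<eta>\<^sub>i + \<eta>\<^sub>j\<close>. The measure \<open>\<nu>\<close> on
  \<open>[0, \<infinity>)\<close> is given as a Borel measure on the reals.
\<close>

definition tau_Upsilon :: "real measure \<Rightarrow> (nat \<Rightarrow> nat \<Rightarrow> real) measure" where
  "tau_Upsilon \<nu> =
     distr (\<Pi>\<^sub>M i\<in>(UNIV :: nat set). \<nu>) borel
       (\<lambda>\<eta> i j. if i \<noteq> j then \<eta> i + \<eta> j else 0)"

text \<open>
  \<^const>\<open>geometric_pmf\<close> counts failures only and hence starts at 0, so it is shifted by 1.
\<close>

definition Ge :: "real \<Rightarrow> real measure" where
  "Ge p = distr (measure_pmf (geometric_pmf p)) borel (\<lambda>k. real (k + 1))"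

lemma measure_Ge:
  assumes "0 < p" "p \<le> 1" "l \<ge> 1"
  shows "measure (Ge p) {real l} = p * (1 - p) ^ (l - 1)"
proof -
  have "(\<lambda>k. real (k + 1)) -` {real l} = {l - 1}"
    using assms(3) by auto
  then have "measure (Ge p) {real l} = pmf (geometric_pmf p) (l - 1)"
    by (simp add: Ge_def measure_distr measure_pmf_single del: of_nat_add)
  then show ?thesis
    using assms by simp
qed

end

theory Submission
  imports Defs "HOL-Computational_Algebra.Formal_Power_Series"
begin

text \<open>
  Let \<open>v\<close> be a vertex of maximal outdegree, so that it has about \<open>(1 - \<kappa>) n\<close> children. Generation
  \<open>l + 1\<close> below a vertex is at least \<open>r < \<kappa>\<close> times as large as generation \<open>l\<close>, except with a
  probability that is exponentially small in the size of generation \<open>l\<close>; this remains true if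
  vertices with more than \<open>K\<close> children are declared childless, for \<open>K\<close> large. The expected total
  progeny is finite, so such exceptions occur nowhere in the unconditioned tree, up to an
  exponentially small probability. Conditioning does no harm, because \<open>P (|T| = n)\<close> is
  supermultiplicative up to a shift and its generating function diverges beyond 1, hence it decays
  slower than any exponential.

  Consequently there are at least about \<open>(1 - \<kappa>) \<kappa> ^ (l - 1) n\<close> vertices at distance \<open>l\<close> below
  \<open>v\<close>, with only boundedly many of them in each branch at \<open>v\<close>. These proportions sum to 1, so the
  lower bounds are sharp: sampled vertices lie in distinct branches, their depths below \<open>v\<close> are
  asymptotically independent and geometric, and their distances are the sums of these depths.
\<close>

text \<open>The vertex \<open>v\<close> is selected by looking at the whole tree, so no law is
  available for the subtree below it. The labels of all words, born or not, are independent, and a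
  union bound over every vertex covers whichever one is selected, at the price of a factor 1 / (1 -
  \<kappa>). The cutoff \<open>K\<close> does two jobs: it bounds the summands, as Hoeffding's
  inequality requires, and it bounds the part of level \<open>l\<close> inside one branch by
  \<open>K ^ (l - 1)\<close>, which does not grow with \<open>n\<close>. The exponential rate is
  halved on purpose: bad growth has probability of order \<open>y ^ (2 * n)\<close>, while
  conditioning divides by at least \<open>C * y ^ n\<close>, so a factor \<open>y ^ n\<close>
  remains. The proportion of vertices at a given depth below \<open>v\<close> is never bounded from
  above. A lower bound for integrals of nonnegative functions is enough, because a bounded test
  function can be shifted and reflected. The constants are chosen in the order: test function, block
  size \<open>m\<close>, depth \<open>L\<close>, error \<open>\<delta>\<close>, growth rate
  \<open>r\<close>, cutoff \<open>K\<close>, rate \<open>y\<close>.\<close>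

unbundle no vec_syntax
unbundle fps_syntax

section \<open>Products of discrete probability spaces\<close>

lemma space_PiM_pmf [simp]: "space (\<Pi>\<^sub>M i\<in>UNIV. measure_pmf (p i)) = UNIV"
  by (simp add: space_PiM)

lemma prob_space_PiM_pmf: "prob_space (\<Pi>\<^sub>M i\<in>I. measure_pmf (p i))"
  by (intro prob_space_PiM) (simp add: measure_pmf.prob_space_axioms)

text \<open>One implication is enough, because \<open>c\<close> and \<open>c'\<close> may be
  exchanged.\<close>

definition depends_only_on :: "'i set \<Rightarrow> ('i \<Rightarrow> 'a) set \<Rightarrow> bool" where
  "depends_only_on A E \<longleftrightarrow> (\<forall>c c'. (\<forall>i\<in>A. c i = c' i) \<longrightarrow> c \<in> E \<longrightarrow> c' \<in> E)"

text \<open>Independence says that the joint law is the product of the marginals; here the joint map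
  is the identity, whose law is the product measure itself.\<close>

lemma indep_vars_PiM_pmf:
  "prob_space.indep_vars (\<Pi>\<^sub>M i\<in>UNIV. measure_pmf (p i)) (\<lambda>i. measure_pmf (p i)) (\<lambda>i \<omega>. \<omega> i) UNIV"
proof -
  let ?M = "\<Pi>\<^sub>M i\<in>UNIV. measure_pmf (p i)"
  interpret prob_space ?M by (rule prob_space_PiM_pmf)
  have *: "distr ?M (measure_pmf (p i)) (\<lambda>\<omega>. \<omega> i) = measure_pmf (p i)" for i
    by (rule distr_PiM_component) (simp_all add: measure_pmf.prob_space_axioms)
  have "distr ?M ?M (\<lambda>x. \<lambda>i\<in>UNIV. x i) = ?M"
    using distr_id[of ?M] by (simp add: restrict_UNIV)
  then show ?thesis
    by (subst indep_vars_iff_distr_eq_PiM') (simp_all add: *)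
qed

text \<open>Restrictions to disjoint index sets are independent, and an event that depends only on
  \<open>A\<close> can be recovered from the restriction to \<open>A\<close>: filling the other
  coordinates with \<open>undefined\<close> turns \<open>G\<close> into its trace
  \<open>X S G\<close> on the partial product.\<close>

lemma prob_Int_disjoint_coordinates:
  fixes p :: "'i \<Rightarrow> 'a pmf"
  assumes E: "E \<in> sets (\<Pi>\<^sub>M i\<in>UNIV. measure_pmf (p i))" and dE: "depends_only_on A E"
    and F: "F \<in> sets (\<Pi>\<^sub>M i\<in>UNIV. measure_pmf (p i))" and dF: "depends_only_on B F"
    and AB: "A \<inter> B = {}"
  shows "measure (\<Pi>\<^sub>M i\<in>UNIV. measure_pmf (p i)) (E \<inter> F) =
    measure (\<Pi>\<^sub>M i\<in>UNIV. measure_pmf (p i)) E * measure (\<Pi>\<^sub>M i\<in>UNIV. measure_pmf (p i)) F"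
proof -
  let ?M = "\<Pi>\<^sub>M i\<in>UNIV. measure_pmf (p i)"
  interpret prob_space ?M by (rule prob_space_PiM_pmf)
  have ext: "(\<lambda>x i. if i \<in> S then x i else undefined) \<in> measurable (PiM S (\<lambda>i. measure_pmf (p i))) ?M" for S
  proof (rule measurable_PiM_single')
    show "(\<lambda>x. if i \<in> S then x i else undefined) \<in> measurable (PiM S (\<lambda>i. measure_pmf (p i))) (measure_pmf (p i))" for i
      by (cases "i \<in> S") auto
  qed auto
  define X where "X S G = (\<lambda>x i. if i \<in> S then x i else undefined) -` G \<inter> space (PiM S (\<lambda>i. measure_pmf (p i)))"
    for S and G :: "('i \<Rightarrow> 'a) set"
  have X: "X S G \<in> sets (PiM S (\<lambda>i. measure_pmf (p i)))" if "G \<in> sets ?M" for S G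
    unfolding X_def using ext that by (rule measurable_sets)
  have restr: "(\<lambda>\<omega>. restrict (\<lambda>i. \<omega> i) S) -` X S G \<inter> space ?M = G" if "depends_only_on S G" for S G
  proof -
    have "(\<lambda>i. if i \<in> S then restrict \<omega> S i else undefined) \<in> G \<longleftrightarrow> \<omega> \<in> G" for \<omega>
    proof
      show "\<omega> \<in> G" if "(\<lambda>i. if i \<in> S then restrict \<omega> S i else undefined) \<in> G"
        by (rule \<open>depends_only_on S G\<close>[unfolded depends_only_on_def, rule_format, OF _ that]) simp
      show "(\<lambda>i. if i \<in> S then restrict \<omega> S i else undefined) \<in> G" if "\<omega> \<in> G"
        by (rule \<open>depends_only_on S G\<close>[unfolded depends_only_on_def, rule_format, OF _ that]) simp
    qed
    then show ?thesis by (auto simp: X_def space_PiM)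
  qed
  have "indep_var (PiM A (\<lambda>i. measure_pmf (p i))) (\<lambda>\<omega>. restrict (\<lambda>i. \<omega> i) A)
          (PiM B (\<lambda>i. measure_pmf (p i))) (\<lambda>\<omega>. restrict (\<lambda>i. \<omega> i) B)"
    by (rule indep_var_restrict[OF indep_vars_PiM_pmf AB subset_UNIV subset_UNIV])
  note indep_varD[OF this X[OF E] X[OF F]]
  moreover have "(\<lambda>x. (restrict (\<lambda>i. x i) A, restrict (\<lambda>i. x i) B)) -` (X A E \<times> X B F) \<inter> space ?M = E \<inter> F"
    using restr[OF dE] restr[OF dF] by blast
  ultimately show ?thesis by (simp only: restr[OF dE] restr[OF dF])
qed

lemma measure_PiM_pmf_vimage_reindex:
  fixes p :: "'a pmf"
  assumes "inj f" and E: "E \<in> sets (\<Pi>\<^sub>M i\<in>UNIV. measure_pmf p)"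
  shows "measure (\<Pi>\<^sub>M i\<in>UNIV. measure_pmf p) {c. (\<lambda>i. c (f i)) \<in> E} =
    measure (\<Pi>\<^sub>M i\<in>UNIV. measure_pmf p) E"
proof -
  have "distr (\<Pi>\<^sub>M i\<in>UNIV. measure_pmf p) (\<Pi>\<^sub>M i\<in>UNIV. measure_pmf p) (\<lambda>\<omega>. \<lambda>n\<in>UNIV. \<omega> (f n)) = (\<Pi>\<^sub>M i\<in>UNIV. measure_pmf p)"
    using assms(1) by (intro distr_PiM_reindex) (auto simp: measure_pmf.prob_space_axioms)
  then have "measure (\<Pi>\<^sub>M i\<in>UNIV. measure_pmf p) E = measure (distr (\<Pi>\<^sub>M i\<in>UNIV. measure_pmf p) (\<Pi>\<^sub>M i\<in>UNIV. measure_pmf p) (\<lambda>\<omega> n. \<omega> (f n))) E"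
    by (simp add: restrict_UNIV)
  also have "\<dots> = measure (\<Pi>\<^sub>M i\<in>UNIV. measure_pmf p) {c. (\<lambda>i. c (f i)) \<in> E}"
    using E by (subst measure_distr) (auto simp: vimage_def intro!: measurable_PiM_single')
  finally show ?thesis by simp
qed

text \<open>The law of total probability with conditional probabilities multiplied out: a bound
  \<open>x\<close> given each \<open>E i\<close> survives averaging over the disjoint
  \<open>E i\<close>. The sum is taken in \<open>ennreal\<close>, which avoids summability
  questions.\<close>

lemma (in prob_space) prob_UN_disjoint_le:
  assumes "countable I" "disjoint_family_on E I"
    and E: "\<And>i. i \<in> I \<Longrightarrow> E i \<in> events" and F: "\<And>i. i \<in> I \<Longrightarrow> F i \<in> events"
    and le: "\<And>i. i \<in> I \<Longrightarrow> prob (E i \<inter> F i) \<le> x * prob (E i)" and "0 \<le> x"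
  shows "prob (\<Union>i\<in>I. E i \<inter> F i) \<le> x"
proof -
  have "emeasure M (\<Union>i\<in>I. E i \<inter> F i) = (\<integral>\<^sup>+i. emeasure M (E i \<inter> F i) \<partial>count_space I)"
    using assms by (intro emeasure_UN_countable) (auto simp: disjoint_family_on_def)
  also have "\<dots> \<le> (\<integral>\<^sup>+i. ennreal x * emeasure M (E i) \<partial>count_space I)"
    using le \<open>0 \<le> x\<close> by (intro nn_integral_mono) (auto simp: emeasure_eq_measure simp flip: ennreal_mult)
  also have "\<dots> = ennreal x * (\<integral>\<^sup>+i. emeasure M (E i) \<partial>count_space I)"
    by (simp add: nn_integral_cmult)
  also have "(\<integral>\<^sup>+i. emeasure M (E i) \<partial>count_space I) = emeasure M (\<Union>i\<in>I. E i)"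
    using assms by (intro emeasure_UN_countable[symmetric]) auto
  also have "ennreal x * emeasure M (\<Union>i\<in>I. E i) \<le> ennreal x * 1"
    by (intro mult_left_mono) (auto simp: emeasure_eq_measure)
  finally show ?thesis
    using \<open>0 \<le> x\<close> by (simp add: emeasure_eq_measure)
qed

section \<open>Family trees and their generations\<close>

abbreviation subtree_labels :: "nat list \<Rightarrow> (nat list \<Rightarrow> nat) \<Rightarrow> nat list \<Rightarrow> nat" where
  "subtree_labels v c \<equiv> (\<lambda>w. c (v @ w))"

lemma family_tree_append_iff:
  "v @ u \<in> family_tree c \<longleftrightarrow> v \<in> family_tree c \<and> u \<in> family_tree (subtree_labels v c)"
proof (induction u rule: rev_induct)
  case Nil
  then show ?case by (simp add: family_tree.root)
next
  case (snoc i u)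
  have step: "w @ [j] \<in> family_tree d \<longleftrightarrow> w \<in> family_tree d \<and> j < d w" for w j d
    by (subst family_tree.simps) auto
  show ?case using snoc step[of "v @ u" i c] step[of u i] by auto
qed

lemma family_tree_snoc_iff: "v @ [i] \<in> family_tree c \<longleftrightarrow> v \<in> family_tree c \<and> i < c v"
  by (subst family_tree.simps) auto

lemma family_tree_Cons_iff:
  "i # u \<in> family_tree c \<longleftrightarrow> i < c [] \<and> u \<in> family_tree (subtree_labels [i] c)"
  using family_tree_append_iff[of "[i]" u c] family_tree_snoc_iff[of "[]" i c]
  by (simp add: family_tree.root)

text \<open>Membership becomes finitely many conditions on the labels of proper prefixes.
  Monotonicity, measurability and the set of labels that matter are all read off from this
  form.\<close>

lemma family_tree_iff: "u \<in> family_tree c \<longleftrightarrow> (\<forall>i<length u. u ! i < c (take i u))"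
proof (induction u rule: rev_induct)
  case Nil
  then show ?case by (simp add: family_tree.root)
next
  case (snoc i u)
  then show ?case
    by (auto simp: family_tree_snoc_iff nth_append less_Suc_eq)
qed

lemma family_tree_mono:
  assumes "\<And>u. d u \<le> c u" shows "family_tree d \<subseteq> family_tree c"
  using assms unfolding family_tree_iff subset_iff by (meson less_le_trans)

definition generation :: "nat \<Rightarrow> (nat list \<Rightarrow> nat) \<Rightarrow> nat list set" where
  "generation l c = {u \<in> family_tree c. length u = l}"

lemma generation_0 [simp]: "generation 0 c = {[]}"
  by (auto simp: generation_def family_tree.root)

lemma generation_Suc:
  "generation (Suc l) c = (\<Union>i<c []. (#) i ` generation l (subtree_labels [i] c))"
  by (auto simp: generation_def family_tree_Cons_iff length_Suc_conv)

text \<open>Splits off the last letter, where \<open>generation_Suc\<close> splits off the first: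
  this form counts the next generation from the current one, the other recurses into the subtrees at
  the root's children.\<close>

lemma generation_Suc_snoc:
  "generation (Suc l) c = (\<Union>u\<in>generation l c. (\<lambda>i. u @ [i]) ` {..<c u})"
proof -
  have "w \<in> generation (Suc l) c \<longleftrightarrow> w \<in> (\<Union>u\<in>generation l c. (\<lambda>i. u @ [i]) ` {..<c u})" for w
    by (cases w rule: rev_cases) (auto simp: generation_def family_tree_snoc_iff)
  then show ?thesis by blast
qed

lemma finite_generation [simp]: "finite (generation l c)"
  by (induction l arbitrary: c) (auto simp: generation_Suc)

lemma card_generation_Suc: "card (generation (Suc l) c) = (\<Sum>u\<in>generation l c. c u)"
  unfolding generation_Suc_snoc
  by (subst card_UN_disjoint) (auto simp: card_image inj_on_def)

lemma card_generation_le: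
  assumes "\<And>u. c u \<le> K" shows "card (generation l c) \<le> K ^ l"
proof (induction l)
  case (Suc l)
  have "card (generation (Suc l) c) \<le> (\<Sum>u\<in>generation l c. K)"
    unfolding card_generation_Suc by (intro sum_mono assms)
  also have "\<dots> \<le> K ^ l * K"
    using Suc by (simp)
  finally show ?case by (simp add: mult.commute)
qed simp

lemma family_tree_UN_generation: "family_tree c = (\<Union>l. generation l c)"
  by (auto simp: generation_def)

lemma finite_family_tree_if_generation_empty:
  assumes "generation l c = {}" shows "finite (family_tree c)"
proof -
  have empty: "generation m c = {}" if "l \<le> m" for m
    using that
  proof (induction m rule: dec_induct)
    case (step m)
    then show ?case by (simp add: generation_Suc_snoc)
  qed (rule assms)
  have "family_tree c \<subseteq> (\<Union>m<l. generation m c)"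
  proof
    fix u assume u: "u \<in> family_tree c"
    then have "u \<in> generation (length u) c" by (simp add: generation_def)
    moreover from this have "length u < l" using empty[of "length u"] by (cases "length u < l") auto
    ultimately show "u \<in> (\<Union>m<l. generation m c)" by blast
  qed
  then show ?thesis
    by (rule finite_subset) auto
qed

lemma outdegree_family_tree:
  assumes "u \<in> family_tree c" shows "outdegree (family_tree c) u = c u"
proof -
  have "{v \<in> family_tree c. \<exists>i. v = u @ [i]} = (\<lambda>i. u @ [i]) ` {..<c u}"
    using assms by (auto simp: family_tree_snoc_iff)
  then show ?thesis
    by (simp add: outdegree_def card_image inj_on_def)
qed

lemma max_outdegree_family_tree:
  assumes "finite (family_tree c)"
  obtains v where "v \<in> family_tree c" "max_outdegree (family_tree c) = c v"
proof -
  have "max_outdegree (family_tree c) \<in> outdegree (family_tree c) ` family_tree c"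
    unfolding max_outdegree_def using assms family_tree.root[of c] by (intro Max_in) auto
  then obtain v where "v \<in> family_tree c" "max_outdegree (family_tree c) = outdegree (family_tree c) v" by blast
  then show ?thesis by (intro that[of v]) (simp_all add: outdegree_family_tree)
qed

lemma family_tree_unfold:
  "family_tree c = insert [] (\<Union>i<c []. (#) i ` family_tree (subtree_labels [i] c))"
proof -
  have "w \<in> family_tree c \<longleftrightarrow> w \<in> insert [] (\<Union>i<c []. (#) i ` family_tree (subtree_labels [i] c))" for w
    by (cases w) (auto simp: family_tree.root family_tree_Cons_iff)
  then show ?thesis by blast
qed

lemma finite_family_tree_iff:
  "finite (family_tree c) \<longleftrightarrow> (\<forall>i<c []. finite (family_tree (subtree_labels [i] c)))"
  by (subst family_tree_unfold) (auto simp: finite_image_iff)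

lemma card_family_tree:
  assumes "finite (family_tree c)"
  shows "card (family_tree c) = Suc (\<Sum>i<c []. card (family_tree (subtree_labels [i] c)))"
proof -
  have fin: "\<forall>i<c []. finite (family_tree (subtree_labels [i] c))"
    using assms finite_family_tree_iff by blast
  have "card (family_tree c) = Suc (card (\<Union>i<c []. (#) i ` family_tree (subtree_labels [i] c)))"
    using fin by (subst family_tree_unfold) (subst card_insert_disjoint, auto)
  also have "card (\<Union>i<c []. (#) i ` family_tree (subtree_labels [i] c)) = (\<Sum>i<c []. card (family_tree (subtree_labels [i] c)))"
    using fin by (subst card_UN_disjoint) (auto simp: card_image)
  finally show ?thesis .
qed

text \<open>The injection \<open>to_nat\<close> carries \<open>S x\<close> to a set of naturals and
  preserves finiteness and cardinality.\<close>

lemma finite_measurable_countable: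
  fixes S :: "'a \<Rightarrow> 'b :: countable set"
  assumes [measurable]: "\<And>i. Measurable.pred M (\<lambda>x. i \<in> S x)"
  shows "Measurable.pred M (\<lambda>x. finite (S x))"
    and "(\<lambda>x. card (S x)) \<in> measurable M (count_space UNIV)"
proof -
  have eq: "n \<in> to_nat ` S x \<longleftrightarrow> (\<exists>i. to_nat i = n \<and> i \<in> S x)" for n x by auto
  have [measurable]: "Measurable.pred M (\<lambda>x. n \<in> to_nat ` S x)" for n
    unfolding eq by measurable
  have "Measurable.pred M (\<lambda>x. finite (to_nat ` S x))" by measurable
  then show "Measurable.pred M (\<lambda>x. finite (S x))"
    by (simp add: finite_image_iff)
  have "(\<lambda>x. card (to_nat ` S x)) \<in> measurable M (count_space UNIV)"
    by (intro measurable_card) simp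
  then show "(\<lambda>x. card (S x)) \<in> measurable M (count_space UNIV)"
    by (simp add: card_image)
qed

section \<open>Measurability and independence on the space of labels\<close>

context
  fixes \<zeta> :: "nat pmf"
begin

interpretation M: prob_space "offspring_space \<zeta>"
  unfolding offspring_space_def by (rule prob_space_PiM_pmf)

lemma space_offspring [simp]: "space (offspring_space \<zeta>) = UNIV"
  by (simp add: offspring_space_def)

lemma measurable_label [measurable]: "(\<lambda>c. c u) \<in> measurable (offspring_space \<zeta>) (count_space UNIV)"
  unfolding offspring_space_def by (rule measurable_compose[OF measurable_component_singleton]) auto

lemma measurable_into_offspring:
  assumes "\<And>u. (\<lambda>x. f x u) \<in> measurable N (count_space UNIV)"
  shows "f \<in> measurable N (offspring_space \<zeta>)"
  unfolding offspring_space_def using assms by (intro measurable_PiM_single') auto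

lemma pred_family_tree [measurable]: "Measurable.pred (offspring_space \<zeta>) (\<lambda>c. u \<in> family_tree c)"
  unfolding family_tree_iff by measurable

lemma measurable_subtree_labels [measurable]:
  "(\<lambda>c. subtree_labels v c) \<in> measurable (offspring_space \<zeta>) (offspring_space \<zeta>)"
  by (rule measurable_into_offspring) measurable

lemma pred_finite_family_tree [measurable]:
  "Measurable.pred (offspring_space \<zeta>) (\<lambda>c. finite (family_tree c))"
  by (rule finite_measurable_countable) measurable

lemma measurable_card_family_tree [measurable]:
  "(\<lambda>c. card (family_tree c)) \<in> measurable (offspring_space \<zeta>) (count_space UNIV)"
  by (rule finite_measurable_countable) measurable

lemma pred_generation [measurable]: "Measurable.pred (offspring_space \<zeta>) (\<lambda>c. u \<in> generation l c)"
  unfolding generation_def mem_Collect_eq by (intro pred_intros_logic pred_family_tree) simp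

lemma measurable_card_generation [measurable]:
  "(\<lambda>c. card (generation l c)) \<in> measurable (offspring_space \<zeta>) (count_space UNIV)"
  by (rule finite_measurable_countable(2)) (rule pred_generation)

lemma sets_size_event [measurable]: "size_event n \<in> sets (offspring_space \<zeta>)"
proof -
  have "size_event n = {c \<in> space (offspring_space \<zeta>). finite (family_tree c)} \<inter>
      ((\<lambda>c. card (family_tree c)) -` {n} \<inter> space (offspring_space \<zeta>))"
    by (auto simp: size_event_def)
  also have "\<dots> \<in> sets (offspring_space \<zeta>)"
    using pred_finite_family_tree measurable_sets[OF measurable_card_family_tree, of "{n}"]
    by (auto simp: pred_def)
  finally show ?thesis .
qed

lemma prob_Int_disjoint_labels:
  assumes "E \<in> sets (offspring_space \<zeta>)" "depends_only_on A E"
    and "F \<in> sets (offspring_space \<zeta>)" "depends_only_on B F" and "A \<inter> B = {}"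
  shows "M.prob (E \<inter> F) = M.prob E * M.prob F"
  using prob_Int_disjoint_coordinates[of E "\<lambda>_. \<zeta>" A F B] assms by (simp add: offspring_space_def)

text \<open>The branching property: prefixing \<open>v\<close> is injective on words, so the labels
  read from \<open>v\<close> are again i.i.d. No condition that \<open>v\<close> is born
  enters.\<close>

lemma prob_subtree_labels:
  assumes "E \<in> sets (offspring_space \<zeta>)"
  shows "M.prob {c. subtree_labels v c \<in> E} = M.prob E"
  unfolding offspring_space_def
  by (rule measure_PiM_pmf_vimage_reindex) (use assms in \<open>auto simp: offspring_space_def inj_on_def\<close>)

lemma prob_label: "M.prob {c. c u \<in> B} = measure_pmf.prob \<zeta> B"
proof -
  have "measure (distr (offspring_space \<zeta>) (measure_pmf \<zeta>) (\<lambda>c. c u)) B = measure_pmf.prob \<zeta> B"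
    unfolding offspring_space_def by (subst distr_PiM_component) (auto simp: measure_pmf.prob_space_axioms)
  then show ?thesis
    by (subst (asm) measure_distr) (auto simp: vimage_def)
qed

end

section \<open>Subexponential decay of the law of the tree size\<close>

text \<open>Fekete's argument: write \<open>n = r + m * q\<close> with \<open>r\<close> from a
  finite set; then \<open>b n\<close> is at least \<open>b r * b m ^ q\<close>, and the second
  factor is at least \<open>y ^ n\<close>. Since \<open>b\<close> may vanish on some residue
  classes, only indices with \<open>0 < b n\<close> are covered.\<close>

lemma supermultiplicative_lower_bound:
  fixes b :: "nat \<Rightarrow> real"
  assumes nonneg: "\<And>n. 0 \<le> b n" and super: "\<And>n m. b n * b m \<le> b (n + m)"
    and y: "0 < y" "y < 1" and m: "1 \<le> m" "y ^ m \<le> b m"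
  shows "\<exists>C>0. \<forall>n. 0 < b n \<longrightarrow> C * y ^ n \<le> b n"
proof -
  \<comment> \<open>The smallest index in the residue class \<open>c\<close> modulo \<open>m\<close>
    at which \<open>b\<close> is positive; \<open>R\<close> collects the classes that have
    one.\<close>
  define r where "r c = (LEAST n. 0 < b n \<and> n mod m = c)" for c
  define R where "R = (\<lambda>n. n mod m) ` {n. 0 < b n}"
  have "R \<subseteq> {..<m}" using m by (auto simp: R_def)
  then have fin: "finite R" by (rule finite_subset) simp
  have r: "0 < b (r c) \<and> r c mod m = c" if c: "c \<in> R" for c
  proof -
    obtain n where "0 < b n \<and> n mod m = c" using c by (auto simp: R_def)
    then show ?thesis unfolding r_def by (rule LeastI)
  qed
  \<comment> \<open>The element 1 makes the set nonempty without further argument.\<close>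
  define C where "C = Min (insert 1 ((\<lambda>c. b (r c)) ` R))"
  have "0 < C" using fin r by (auto simp: C_def)
  moreover have "C * y ^ n \<le> b n" if n: "0 < b n" for n
  proof -
    have c: "n mod m \<in> R" using n by (auto simp: R_def)
    have le: "r (n mod m) \<le> n" unfolding r_def using n by (intro Least_le) auto
    have "m dvd n - r (n mod m)"
      using r[OF c] le by (metis mod_eq_dvd_iff_nat)
    then obtain q where q: "n = r (n mod m) + m * q"
      using le by (metis dvd_def le_add_diff_inverse)
    have step: "b k * b m ^ j \<le> b (k + m * j)" for k j
    proof (induction j)
      case (Suc j)
      have "b k * b m ^ Suc j = (b k * b m ^ j) * b m" by simp
      also have "\<dots> \<le> b (k + m * j) * b m" using Suc nonneg by (intro mult_right_mono) auto
      also have "\<dots> \<le> b (k + m * Suc j)" using super[of "k + m * j" m] by (simp add: ac_simps)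
      finally show ?case .
    qed simp
    have "C * y ^ n \<le> C * (y ^ m) ^ q"
    proof (intro mult_left_mono)
      have "m * q \<le> n" using q by linarith
      then show "y ^ n \<le> (y ^ m) ^ q"
        using y unfolding power_mult[symmetric] by (intro power_decreasing) auto
    qed (use \<open>0 < C\<close> in simp)
    also have "\<dots> \<le> b (r (n mod m)) * b m ^ q"
      using m y c fin r[OF c] by (intro mult_mono power_mono) (auto simp: C_def)
    also have "\<dots> \<le> b n" using step[of "r (n mod m)" q] q by simp
    finally show ?thesis .
  qed
  ultimately show ?thesis by blast
qed

context
  fixes \<zeta> :: "nat pmf"
begin

interpretation M: prob_space "offspring_space \<zeta>"
  unfolding offspring_space_def by (rule prob_space_PiM_pmf)

lemma sets_subtree_labels_vimage:
  assumes "E \<in> sets (offspring_space \<zeta>)"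
  shows "{c. subtree_labels v c \<in> E} \<in> sets (offspring_space \<zeta>)"
  using measurable_sets[OF measurable_subtree_labels[where v = v] assms] by (simp add: vimage_def)

lemma sets_label: "{c. c u \<in> B} \<in> sets (offspring_space \<zeta>)"
  using measurable_sets[OF measurable_label[where u = u and \<zeta> = \<zeta>], of B] by (simp add: vimage_def)

lemma depends_only_on_label: "depends_only_on {u} {c. c u \<in> B}"
  by (auto simp: depends_only_on_def)

lemma depends_only_on_subtree: "depends_only_on (range ((@) v)) {c. subtree_labels v c \<in> E}"
proof -
  have "subtree_labels v c = subtree_labels v c'" if "\<forall>i\<in>range ((@) v). c i = c' i" for c c' :: "nat list \<Rightarrow> nat"
    using that by auto
  then show ?thesis unfolding depends_only_on_def by (metis mem_Collect_eq)
qed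

section \<open>First moment bounds over the vertices of the unconditioned tree\<close>

definition descendant_event :: "nat \<Rightarrow> (nat list \<Rightarrow> nat) set \<Rightarrow> (nat list \<Rightarrow> nat) set" where
  "descendant_event l E = {c. \<exists>v\<in>generation l c. subtree_labels v c \<in> E}"

lemma sets_descendant_event:
  assumes E: "E \<in> sets (offspring_space \<zeta>)"
  shows "descendant_event l E \<in> sets (offspring_space \<zeta>)"
proof -
  have "descendant_event l E = (\<Union>v. {c \<in> space (offspring_space \<zeta>). v \<in> generation l c} \<inter> {c. subtree_labels v c \<in> E})"
    by (auto simp: descendant_event_def)
  also have "\<dots> \<in> sets (offspring_space \<zeta>)"
    using sets_subtree_labels_vimage[OF E] pred_generation[where l = l and \<zeta> = \<zeta>]
    by (intro sets.countable_UN' sets.Int) (auto simp: pred_def)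
  finally show ?thesis .
qed

text \<open>The tail formula for the mean. It appears because the child \<open>[i]\<close> of the
  root is born exactly when the root's label exceeds \<open>i\<close>.\<close>

lemma suminf_tail_prob:
  assumes "integrable (measure_pmf \<zeta>) real"
  shows "(\<Sum>i. ennreal (measure_pmf.prob \<zeta> {i<..})) = ennreal (measure_pmf.expectation \<zeta> real)"
proof -
  have "(\<Sum>i. ennreal (measure_pmf.prob \<zeta> {i<..})) = (\<Sum>i. emeasure (measure_pmf \<zeta>) {k\<in>space (measure_pmf \<zeta>). i < k})"
    by (simp add: measure_pmf.emeasure_eq_measure greaterThan_def)
  also have "\<dots> = (\<integral>\<^sup>+k. of_nat k \<partial>measure_pmf \<zeta>)"
    by (rule nn_integral_nat_function[symmetric]) simp
  also have "\<dots> = (\<integral>\<^sup>+k. ennreal (real k) \<partial>measure_pmf \<zeta>)"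
    by (simp add: ennreal_of_nat_eq_real_of_nat)
  also have "\<dots> = ennreal (measure_pmf.expectation \<zeta> real)"
    using assms by (intro nn_integral_eq_integral) auto
  finally show ?thesis .
qed

text \<open>A union bound over the root's possible children: that \<open>[i]\<close> is born depends
  on the root's label alone, hence is independent of what happens below \<open>[i]\<close>. Summing
  the tails over \<open>i\<close> gives one factor of the mean per generation.\<close>

lemma prob_descendant_event:
  assumes int: "integrable (measure_pmf \<zeta>) real" and E: "E \<in> sets (offspring_space \<zeta>)"
  shows "M.prob (descendant_event l E) \<le> measure_pmf.expectation \<zeta> real ^ l * M.prob E"
proof (induction l)
  case 0
  have "descendant_event 0 E = E" by (auto simp: descendant_event_def)
  then show ?case by simp
next
  case (Suc l)
  let ?\<kappa> = "measure_pmf.expectation \<zeta> real"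
  let ?D = "descendant_event l E"
  let ?F = "\<lambda>i. {c. c [] \<in> {i<..}} \<inter> {c. subtree_labels [i] c \<in> ?D}"
  have \<kappa>: "0 \<le> ?\<kappa>" by simp
  have sets: "?F i \<in> sets (offspring_space \<zeta>)" for i
    by (intro sets.Int sets_label sets_subtree_labels_vimage sets_descendant_event E)
  have "descendant_event (Suc l) E \<subseteq> (\<Union>i. ?F i)"
  proof
    fix c assume "c \<in> descendant_event (Suc l) E"
    then obtain i v where "i < c []" "v \<in> generation l (subtree_labels [i] c)"
        "subtree_labels (i # v) c \<in> E"
      unfolding descendant_event_def generation_Suc by blast
    then have "c \<in> ?F i" by (auto simp: descendant_event_def)
    then show "c \<in> (\<Union>i. ?F i)" by blast
  qed
  then have "emeasure (offspring_space \<zeta>) (descendant_event (Suc l) E) \<le> emeasure (offspring_space \<zeta>) (\<Union>i. ?F i)"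
    by (rule emeasure_mono) (use sets in blast)
  also have "\<dots> \<le> (\<Sum>i. emeasure (offspring_space \<zeta>) (?F i))"
    by (rule emeasure_subadditive_countably) (use sets in blast)
  also have "\<dots> = (\<Sum>i. ennreal (M.prob ?D) * ennreal (measure_pmf.prob \<zeta> {i<..}))"
  proof (intro arg_cong[where f = suminf] ext)
    fix i
    have "M.prob (?F i) = M.prob {c. c [] \<in> {i<..}} * M.prob {c. subtree_labels [i] c \<in> ?D}"
      by (intro prob_Int_disjoint_labels[OF sets_label depends_only_on_label _ depends_only_on_subtree]
          sets_subtree_labels_vimage sets_descendant_event E) auto
    also have "\<dots> = measure_pmf.prob \<zeta> {i<..} * M.prob ?D"
      by (subst prob_label, subst prob_subtree_labels) (auto intro: sets_descendant_event E)
    finally show "emeasure (offspring_space \<zeta>) (?F i) = ennreal (M.prob ?D) * ennreal (measure_pmf.prob \<zeta> {i<..})"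
      by (simp add: M.emeasure_eq_measure ennreal_mult'' mult.commute)
  qed
  also have "\<dots> = ennreal (M.prob ?D) * ennreal ?\<kappa>"
    by (simp add: suminf_tail_prob[OF int])
  also have "\<dots> = ennreal (M.prob ?D * ?\<kappa>)"
    by (simp add: ennreal_mult'')
  finally have "M.prob (descendant_event (Suc l) E) \<le> M.prob ?D * ?\<kappa>"
    using \<kappa> by (simp add: M.emeasure_eq_measure)
  also have "\<dots> \<le> (?\<kappa> ^ l * M.prob E) * ?\<kappa>"
    by (rule mult_right_mono[OF Suc \<kappa>])
  finally show ?case by (simp add: ac_simps)
qed

text \<open>Sums the bound over all generations; the geometric series is the expected total
  progeny.\<close>

lemma prob_Union_descendant_event:
  assumes int: "integrable (measure_pmf \<zeta>) real" and \<kappa>: "measure_pmf.expectation \<zeta> real < 1"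
    and E: "E \<in> sets (offspring_space \<zeta>)"
  shows "M.prob {c. \<exists>v\<in>family_tree c. subtree_labels v c \<in> E} \<le> M.prob E / (1 - measure_pmf.expectation \<zeta> real)"
proof -
  let ?\<kappa> = "measure_pmf.expectation \<zeta> real"
  have \<kappa>0: "0 \<le> ?\<kappa>" by simp
  have "(\<lambda>l. ?\<kappa> ^ l) sums (1 / (1 - ?\<kappa>))"
    by (rule geometric_sums) (use \<kappa> \<kappa>0 in simp)
  from sums_mult2[OF this, of "M.prob E"]
  have sums: "(\<lambda>l. ?\<kappa> ^ l * M.prob E) sums (M.prob E / (1 - ?\<kappa>))" by simp
  have summ: "summable (\<lambda>l. M.prob (descendant_event l E))"
    by (rule summable_comparison_test'[OF sums_summable[OF sums], of 0])
       (simp add: prob_descendant_event[OF int E])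
  have "{c. \<exists>v\<in>family_tree c. subtree_labels v c \<in> E} = (\<Union>l. descendant_event l E)"
    by (auto simp: descendant_event_def family_tree_UN_generation)
  also have "M.prob \<dots> \<le> (\<Sum>l. M.prob (descendant_event l E))"
    by (rule M.finite_measure_subadditive_countably[OF _ summ]) (use sets_descendant_event[OF E] in blast)
  also have "\<dots> \<le> M.prob E / (1 - ?\<kappa>)"
    by (rule sums_le[OF prob_descendant_event[OF int E] summable_sums[OF summ] sums])
  finally show ?thesis .
qed

text \<open>An infinite tree has no empty generation, so it lies in
  \<open>descendant_event l UNIV\<close> for every \<open>l\<close>, an event of probability at most
  the \<open>l\<close>-th power of the mean. Hence the tree is almost surely finite.\<close>

lemma size_prob_sums_1:
  assumes int: "integrable (measure_pmf \<zeta>) real" and \<kappa>: "measure_pmf.expectation \<zeta> real < 1"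
  shows "(\<lambda>n. M.prob (size_event n)) sums 1"
proof -
  let ?\<kappa> = "measure_pmf.expectation \<zeta> real"
  have fin: "{c. finite (family_tree c)} \<in> sets (offspring_space \<zeta>)"
    using pred_finite_family_tree[where \<zeta> = \<zeta>] by (simp add: pred_def)
  have "M.prob (- {c. finite (family_tree c)}) \<le> ?\<kappa> ^ l" for l
  proof -
    have "- {c. finite (family_tree c)} \<subseteq> descendant_event l UNIV"
      using finite_family_tree_if_generation_empty[of l] unfolding descendant_event_def by blast
    then have "M.prob (- {c. finite (family_tree c)}) \<le> M.prob (descendant_event l UNIV)"
      by (intro M.finite_measure_mono sets_descendant_event) (use sets.top[of "offspring_space \<zeta>"] in auto)
    also have "\<dots> \<le> ?\<kappa> ^ l * M.prob UNIV"
      by (intro prob_descendant_event int) (use sets.top[of "offspring_space \<zeta>"] in auto)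
    also have "M.prob UNIV = 1" using M.prob_space by simp
    finally show ?thesis by simp
  qed
  moreover have "(\<lambda>l. ?\<kappa> ^ l) \<longlonglongrightarrow> 0" using \<kappa> by (intro LIMSEQ_power_zero) auto
  ultimately have "M.prob (- {c. finite (family_tree c)}) \<le> 0"
    by (intro LIMSEQ_le_const[of "\<lambda>l. ?\<kappa> ^ l"]) auto
  then have 1: "M.prob {c. finite (family_tree c)} = 1"
    using M.prob_compl[OF fin] by (simp add: Compl_eq_Diff_UNIV measure_le_0_iff)
  have "(\<lambda>n. M.prob (size_event n)) sums M.prob (\<Union>n. size_event n)"
    using sets_size_event by (intro M.finite_measure_UNION) (auto simp: disjoint_family_on_def size_event_def)
  also have "(\<Union>n. size_event n) = {c. finite (family_tree c)}"
    by (auto simp: size_event_def)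
  finally show ?thesis using 1 by simp
qed

section \<open>The generating function of the tree size\<close>

definition size_fps :: "real fps" where
  "size_fps = Abs_fps (\<lambda>n. M.prob (size_event n))"

lemma size_fps_nth: "size_fps $ n = M.prob (size_event n)"
  by (simp add: size_fps_def)

text \<open>The trees at the words \<open>[0]\<close>, ..., \<open>[k - 1]\<close> are taken whether
  or not the root has \<open>k\<close> children, which makes the event independent of the root's
  label.\<close>

definition forest_event :: "nat \<Rightarrow> nat \<Rightarrow> (nat list \<Rightarrow> nat) set" where
  "forest_event k s = {c. (\<forall>i<k. finite (family_tree (subtree_labels [i] c))) \<and>
      (\<Sum>i<k. card (family_tree (subtree_labels [i] c))) = s}"

lemma sets_forest_event: "forest_event k s \<in> sets (offspring_space \<zeta>)"
proof (induction k arbitrary: s)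
  case 0
  then show ?case using sets.top[of "offspring_space \<zeta>"] by (cases "s = 0") (auto simp: forest_event_def)
next
  case (Suc k)
  have "forest_event (Suc k) s = (\<Union>i\<in>{0..s}. {c. subtree_labels [k] c \<in> size_event i} \<inter> forest_event k (s - i))"
    by (auto simp: forest_event_def size_event_def less_Suc_eq)
  also have "\<dots> \<in> sets (offspring_space \<zeta>)"
    by (intro sets.finite_UN sets.Int Suc sets_subtree_labels_vimage sets_size_event) auto
  finally show ?case .
qed

lemma depends_only_on_forest_event: "depends_only_on {w. w \<noteq> [] \<and> hd w < k} (forest_event k s)"
proof -
  have "subtree_labels [i] c = subtree_labels [i] c'"
    if "\<forall>w\<in>{w. w \<noteq> [] \<and> hd w < k}. c w = c' w" "i < k" for c c' :: "nat list \<Rightarrow> nat" and i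
    using that by auto
  then show ?thesis unfolding depends_only_on_def forest_event_def by auto
qed

text \<open>Words starting with \<open>k\<close> and words starting with a smaller letter are
  disjoint, so the last tree is independent of the others; the resulting convolution is the product
  of power series.\<close>

lemma prob_forest_event: "M.prob (forest_event k s) = (size_fps ^ k) $ s"
proof (induction k arbitrary: s)
  case 0
  then show ?case using M.prob_space by (auto simp: forest_event_def)
next
  case (Suc k)
  let ?F = "\<lambda>i. {c. subtree_labels [k] c \<in> size_event i} \<inter> forest_event k (s - i)"
  have sets: "?F i \<in> sets (offspring_space \<zeta>)" for i
    by (intro sets.Int sets_forest_event sets_subtree_labels_vimage sets_size_event)
  have "forest_event (Suc k) s = (\<Union>i\<in>{0..s}. ?F i)"
    by (auto simp: forest_event_def size_event_def less_Suc_eq)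
  also have "M.prob \<dots> = (\<Sum>i\<in>{0..s}. M.prob (?F i))"
    using sets by (intro M.finite_measure_finite_Union) (auto simp: disjoint_family_on_def size_event_def)
  also have "\<dots> = (\<Sum>i\<in>{0..s}. size_fps $ i * (size_fps ^ k) $ (s - i))"
  proof (intro sum.cong refl)
    fix i
    have "M.prob (?F i) = M.prob {c. subtree_labels [k] c \<in> size_event i} * M.prob (forest_event k (s - i))"
      by (intro prob_Int_disjoint_labels[OF _ depends_only_on_subtree _ depends_only_on_forest_event]
          sets_subtree_labels_vimage sets_size_event sets_forest_event) auto
    then show "M.prob (?F i) = size_fps $ i * (size_fps ^ k) $ (s - i)"
      by (simp only: prob_subtree_labels[OF sets_size_event] Suc size_fps_nth)
  qed
  finally show ?case by (simp add: fps_mult_nth)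
qed

lemma prob_label_forest_event:
  "M.prob ({c. c [] = k} \<inter> forest_event k n) = pmf \<zeta> k * (size_fps ^ k) $ n"
proof -
  have "M.prob ({c. c [] \<in> {k}} \<inter> forest_event k n) = M.prob {c. c [] \<in> {k}} * M.prob (forest_event k n)"
    by (intro prob_Int_disjoint_labels[OF sets_label depends_only_on_label sets_forest_event depends_only_on_forest_event]) auto
  then show ?thesis
    by (simp only: prob_label prob_forest_event) (simp add: measure_pmf_single)
qed

lemma prob_UN_label_forest_event:
  "M.prob (\<Union>k\<in>{0..N}. {c. c [] = k} \<inter> forest_event k n) = (\<Sum>k=0..N. pmf \<zeta> k * (size_fps ^ k) $ n)"
proof -
  have sets: "{c. c [] = k} \<inter> forest_event k n \<in> sets (offspring_space \<zeta>)" for k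
    using sets_label[of "[]" "{k}"] sets_forest_event by auto
  have "M.prob (\<Union>k\<in>{0..N}. {c. c [] = k} \<inter> forest_event k n) = (\<Sum>k=0..N. M.prob ({c. c [] = k} \<inter> forest_event k n))"
  proof (rule M.finite_measure_finite_Union)
    show "disjoint_family_on (\<lambda>k. {c. c [] = k} \<inter> forest_event k n) {0..N}"
      unfolding disjoint_family_on_def by blast
  qed (use sets in blast)+
  then show ?thesis
    by (simp only: prob_label_forest_event)
qed

lemma label_forest_event_subset: "{c. c [] = k} \<inter> forest_event k n \<subseteq> size_event (Suc n)"
proof
  fix c assume c: "c \<in> {c. c [] = k} \<inter> forest_event k n"
  then have fin: "finite (family_tree c)"
    by (subst finite_family_tree_iff) (auto simp: forest_event_def)
  then show "c \<in> size_event (Suc n)"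
    using card_family_tree[OF fin] c by (auto simp: forest_event_def size_event_def)
qed

lemma card_family_tree_pos: "finite (family_tree c) \<Longrightarrow> 1 \<le> card (family_tree c)"
  using card_family_tree[of c] by linarith

lemma size_event_Suc: "size_event (Suc n) = (\<Union>k\<in>{0..n}. {c. c [] = k} \<inter> forest_event k n)"
proof
  show "size_event (Suc n) \<subseteq> (\<Union>k\<in>{0..n}. {c. c [] = k} \<inter> forest_event k n)"
  proof
    fix c assume "c \<in> size_event (Suc n)"
    then have fin: "finite (family_tree c)" and card: "card (family_tree c) = Suc n"
      by (auto simp: size_event_def)
    then have sum: "(\<Sum>i<c []. card (family_tree (subtree_labels [i] c))) = n"
      using card_family_tree[OF fin] card by linarith
    have "(\<Sum>i<c []. 1) \<le> (\<Sum>i<c []. card (family_tree (subtree_labels [i] c)))"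
      using fin finite_family_tree_iff[of c] by (intro sum_mono card_family_tree_pos) auto
    then have "c [] \<le> n" using sum by simp
    then show "c \<in> (\<Union>k\<in>{0..n}. {c. c [] = k} \<inter> forest_event k n)"
      using fin sum finite_family_tree_iff[of c] by (auto simp: forest_event_def)
  qed
qed (use label_forest_event_subset in auto)

text \<open>The functional equation g = z f(g) between the generating functions of the tree size and
  of the offspring law, read off coefficientwise. The sum stops at \<open>n\<close> because each
  child's tree has at least one vertex.\<close>

lemma size_fps_Suc: "size_fps $ Suc n = (\<Sum>k=0..n. pmf \<zeta> k * (size_fps ^ k) $ n)"
  by (simp add: size_fps_nth size_event_Suc prob_UN_label_forest_event)

text \<open>The cutoff \<open>N\<close> is independent of \<open>n\<close>, so that for fixed
  \<open>N\<close> the inequality can be summed over all \<open>n\<close>.\<close>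

lemma sum_le_size_fps_Suc: "(\<Sum>k=0..N. pmf \<zeta> k * (size_fps ^ k) $ n) \<le> size_fps $ Suc n"
  unfolding prob_UN_label_forest_event[symmetric] size_fps_nth
  using label_forest_event_subset by (intro M.finite_measure_mono sets_size_event) auto

lemma size_fps_0 [simp]: "size_fps $ 0 = 0"
proof -
  have "size_event 0 = {}" using card_family_tree_pos by (force simp: size_event_def)
  then show ?thesis by (simp add: size_fps_nth)
qed

lemma size_fps_power_nonneg: "0 \<le> (size_fps ^ k) $ n"
  unfolding prob_forest_event[symmetric] by simp

lemma size_fps_nonneg: "0 \<le> size_fps $ n"
  by (simp add: size_fps_nth)

text \<open>Grafting: following first children in a tree with \<open>n + 1\<close> vertices leads to
  a leaf, and replacing this leaf by a tree with \<open>m + 1\<close> vertices gives one with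
  \<open>n + m + 1\<close> vertices. The induction descends along these first children; the lost
  leaf explains the shift in the indices.\<close>

lemma size_fps_supermultiplicative: "size_fps $ Suc n * size_fps $ Suc m \<le> size_fps $ Suc (n + m)"
proof (induction n rule: less_induct)
  case (less n)
  have step: "(size_fps ^ k) $ n * size_fps $ Suc m \<le> (size_fps ^ k) $ (n + m)" if k: "k \<noteq> 0" for k
  proof -
    obtain j where Suc: "k = Suc j" using k by (cases k) auto
    have pow: "(size_fps ^ k) $ s = (\<Sum>i=0..s. size_fps $ i * (size_fps ^ j) $ (s - i))" for s
      by (simp only: Suc power_Suc fps_mult_nth)
    have "(size_fps ^ k) $ n * size_fps $ Suc m = (\<Sum>i=0..n. (size_fps $ i * size_fps $ Suc m) * (size_fps ^ j) $ (n - i))"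
      unfolding pow sum_distrib_right by (intro sum.cong refl) simp
    also have "\<dots> \<le> (\<Sum>i=0..n. size_fps $ (i + m) * (size_fps ^ j) $ (n - i))"
    proof (intro sum_mono mult_right_mono size_fps_power_nonneg)
      fix i assume i: "i \<in> {0..n}"
      \<comment> \<open>The first tree of the forest absorbs the \<open>m\<close> additional
        vertices. There is no tree with \<open>i = 0\<close> vertices, and \<open>i = Suc i'\<close>
        gives \<open>i' < n\<close>, where the induction hypothesis applies.\<close>
      show "size_fps $ i * size_fps $ Suc m \<le> size_fps $ (i + m)"
      proof (cases i)
        case 0
        then show ?thesis by (simp add: size_fps_nonneg)
      next
        case (Suc i')
        then show ?thesis using less[of i'] i by simp
      qed
    qed
    also have "\<dots> = (\<Sum>i\<in>(\<lambda>i. i + m) ` {0..n}. size_fps $ i * (size_fps ^ j) $ (n + m - i))"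
      by (subst sum.reindex) (auto simp: inj_on_def)
    also have "\<dots> \<le> (\<Sum>i=0..n + m. size_fps $ i * (size_fps ^ j) $ (n + m - i))"
      by (intro sum_mono2) (auto simp: size_fps_nonneg size_fps_power_nonneg)
    finally show ?thesis unfolding pow .
  qed
  show ?case
  proof (cases "n = 0")
    \<comment> \<open>A single vertex has no child to absorb the second tree; it is itself the leaf
      to be replaced, and its probability is bounded by 1.\<close>
    case True
    have "size_fps $ Suc n \<le> 1" unfolding size_fps_nth by simp
    then have "size_fps $ Suc n * size_fps $ Suc m \<le> 1 * size_fps $ Suc m"
      by (rule mult_right_mono[OF _ size_fps_nonneg])
    then show ?thesis using True by simp
  next
    case False
    have "size_fps $ Suc n * size_fps $ Suc m = (\<Sum>k=0..n. pmf \<zeta> k * ((size_fps ^ k) $ n * size_fps $ Suc m))"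
      unfolding size_fps_Suc[of n] sum_distrib_right by (intro sum.cong refl) simp
    also have "\<dots> \<le> (\<Sum>k=0..n. pmf \<zeta> k * (size_fps ^ k) $ (n + m))"
    proof (intro sum_mono mult_left_mono)
      fix k
      show "(size_fps ^ k) $ n * size_fps $ Suc m \<le> (size_fps ^ k) $ (n + m)"
        using step[of k] False by (cases "k = 0") auto
    qed auto
    also have "\<dots> \<le> size_fps $ Suc (n + m)" by (rule sum_le_size_fps_Suc)
    finally show ?thesis .
  qed
qed

text \<open>If the generating function \<open>g\<close> of the tree size converged at some \<open>y > 1\<close>, then \<open>g = y f(g)\<close>
  would make the generating function \<open>f\<close> of \<open>\<zeta>\<close> finite at \<open>g > 1\<close>.\<close>

lemma size_fps_not_summable:
  assumes int: "integrable (measure_pmf \<zeta>) real" and \<kappa>: "measure_pmf.expectation \<zeta> real < 1"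
    and heavy: "\<And>R :: real. R > 1 \<Longrightarrow> (\<integral>\<^sup>+k. ennreal (R ^ k) \<partial>measure_pmf \<zeta>) = \<infinity>"
    and y: "1 < y"
  shows "\<not> summable (\<lambda>n. size_fps $ n * y ^ n)"
proof
  assume summ: "summable (\<lambda>n. size_fps $ n * y ^ n)"
  define g where "g = (\<Sum>n. size_fps $ n * y ^ n)"
  have g: "(\<lambda>n. size_fps $ n * y ^ n) sums g" using summ by (simp add: g_def summable_sums)
  have 1: "(\<lambda>n. size_fps $ n * y) sums (1 * y)"
    unfolding size_fps_nth by (rule sums_mult2[OF size_prob_sums_1[OF int \<kappa>]])
  \<comment> \<open>Trees are nonempty, so every term with positive coefficient carries at least one
    factor \<open>y\<close>; as the coefficients sum to 1, \<open>g\<close> is at least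
    \<open>y\<close>.\<close>
  have "size_fps $ n * y \<le> size_fps $ n * y ^ n" for n
  proof (cases n)
    case (Suc k)
    then show ?thesis
      using self_le_power[of y n] y by (intro mult_left_mono size_fps_nonneg) auto
  qed simp
  from sums_le[OF this 1 g] have "y \<le> g" by simp
  then have g1: "1 < g" using y by simp
  have pow: "(\<lambda>n. (size_fps ^ k) $ n * y ^ n) sums g ^ k" for k
  proof (induction k)
    case 0
    have "(\<lambda>n. (1 :: real fps) $ n * y ^ n) = (\<lambda>n. if n = 0 then 1 else 0)" by auto
    then show ?case using sums_single[of 0 "\<lambda>_. 1 :: real"] by simp
  next
    case (Suc k)
    have "(\<lambda>n. \<Sum>i\<le>n. (size_fps $ i * y ^ i) * ((size_fps ^ k) $ (n - i) * y ^ (n - i))) sums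
        ((\<Sum>n. size_fps $ n * y ^ n) * (\<Sum>n. (size_fps ^ k) $ n * y ^ n))"
    proof (rule Cauchy_product_sums)
      have "norm ((size_fps ^ j) $ n * y ^ n) = (size_fps ^ j) $ n * y ^ n" for j n
        using y size_fps_power_nonneg[of j n] by simp
      from this[of 1] this[of k] show "summable (\<lambda>n. norm (size_fps $ n * y ^ n))"
          "summable (\<lambda>n. norm ((size_fps ^ k) $ n * y ^ n))"
        using summ sums_summable[OF Suc] by simp_all
    qed
    also have "(\<lambda>n. \<Sum>i\<le>n. (size_fps $ i * y ^ i) * ((size_fps ^ k) $ (n - i) * y ^ (n - i))) =
        (\<lambda>n. (size_fps ^ Suc k) $ n * y ^ n)"
    proof
      fix n
      have "(size_fps $ i * y ^ i) * ((size_fps ^ k) $ (n - i) * y ^ (n - i)) =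
          (size_fps $ i * (size_fps ^ k) $ (n - i)) * y ^ n" if "i \<le> n" for i
        using that power_add[of y i "n - i"] by simp
      then show "(\<Sum>i\<le>n. (size_fps $ i * y ^ i) * ((size_fps ^ k) $ (n - i) * y ^ (n - i))) =
          (size_fps ^ Suc k) $ n * y ^ n"
        unfolding power_Suc fps_mult_nth sum_distrib_right atLeast0AtMost
        by (intro sum.cong refl) simp
    qed
    also have "(\<Sum>n. (size_fps ^ k) $ n * y ^ n) = g ^ k" by (rule sums_unique[OF Suc, symmetric])
    finally show ?case by (simp only: g_def power_Suc)
  qed
  \<comment> \<open>Partial sums of f(g) = g / y. The outer sum is kept finite, so that it can be
    exchanged with the series in \<open>n\<close>.\<close>
  have bound: "(\<Sum>k=0..N. pmf \<zeta> k * g ^ k) \<le> g / y" for N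
  proof -
    have 1: "(\<lambda>n. \<Sum>k=0..N. pmf \<zeta> k * ((size_fps ^ k) $ n * y ^ n)) sums (\<Sum>k=0..N. pmf \<zeta> k * g ^ k)"
      by (intro sums_sum sums_mult pow)
    have "(\<lambda>n. size_fps $ Suc n * y ^ Suc n) sums (g - size_fps $ 0 * y ^ 0)"
      using sums_Suc_iff[of "\<lambda>n. size_fps $ n * y ^ n"] g by simp
    then have 2: "(\<lambda>n. size_fps $ Suc n * y ^ Suc n / y) sums (g / y)"
      by (intro sums_divide) simp
    show ?thesis
    proof (rule sums_le[OF _ 1 2])
      fix n
      have "(\<Sum>k=0..N. pmf \<zeta> k * ((size_fps ^ k) $ n * y ^ n)) = (\<Sum>k=0..N. pmf \<zeta> k * (size_fps ^ k) $ n) * y ^ n"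
        unfolding sum_distrib_right by (intro sum.cong refl) simp
      also have "\<dots> \<le> size_fps $ Suc n * y ^ n"
        using y by (intro mult_right_mono sum_le_size_fps_Suc) auto
      finally show "(\<Sum>k=0..N. pmf \<zeta> k * ((size_fps ^ k) $ n * y ^ n)) \<le> size_fps $ Suc n * y ^ Suc n / y"
        using y by simp
    qed
  qed
  have "(\<integral>\<^sup>+k. ennreal (g ^ k) \<partial>measure_pmf \<zeta>) = (\<Sum>k. ennreal (pmf \<zeta> k * g ^ k))"
    using g1 by (simp add: nn_integral_measure_pmf nn_integral_count_space_nat ennreal_mult'')
  also have "\<dots> \<le> ennreal (g / y)"
    unfolding suminf_eq_SUP
  proof (rule SUP_least)
    fix N
    have "(\<Sum>k<N. ennreal (pmf \<zeta> k * g ^ k)) = ennreal (\<Sum>k<N. pmf \<zeta> k * g ^ k)"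
      using g1 by (intro sum_ennreal) auto
    also have "\<dots> \<le> ennreal (\<Sum>k=0..N. pmf \<zeta> k * g ^ k)"
      using g1 by (intro ennreal_leI sum_mono2) auto
    also have "\<dots> \<le> ennreal (g / y)" by (intro ennreal_leI bound)
    finally show "(\<Sum>k<N. ennreal (pmf \<zeta> k * g ^ k)) \<le> ennreal (g / y)" .
  qed
  finally show False using heavy[OF g1] by (simp add: top_unique)
qed

text \<open>If \<open>size_fps $ Suc m\<close> stayed below \<open>y ^ m\<close> for all positive
  \<open>m\<close>, the generating function would converge beyond 1. One index \<open>m\<close>
  where it does not is all that supermultiplicativity needs.\<close>

lemma size_prob_lower_bound:
  assumes int: "integrable (measure_pmf \<zeta>) real" and \<kappa>: "measure_pmf.expectation \<zeta> real < 1"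
    and heavy: "\<And>R :: real. R > 1 \<Longrightarrow> (\<integral>\<^sup>+k. ennreal (R ^ k) \<partial>measure_pmf \<zeta>) = \<infinity>"
    and y: "0 < y" "y < 1"
  shows "\<exists>C>0. \<forall>n. 0 < M.prob (size_event n) \<longrightarrow> C * y ^ n \<le> M.prob (size_event n)"
proof -
  have "\<exists>m\<ge>1. y ^ m \<le> size_fps $ Suc m"
  proof (rule ccontr)
    assume "\<not> ?thesis"
    then have less: "size_fps $ Suc m \<le> y ^ m" if "1 \<le> m" for m using that by force
    \<comment> \<open>Any \<open>z > 1\<close> with \<open>y * z < 1\<close> would serve; this one
      gives a geometric series with ratio \<open>sqrt y\<close>.\<close>
    define z where "z = 1 / sqrt y"
    have z: "1 < z" "0 < z" using y by (auto simp: z_def)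
    have yz: "y * z = sqrt y" using y by (simp add: z_def real_div_sqrt)
    have "summable (\<lambda>m. z * sqrt y ^ m)"
      using y by (intro summable_mult summable_geometric) (auto simp: real_sqrt_lt_1_iff)
    then have "summable (\<lambda>m. size_fps $ Suc m * z ^ Suc m)"
    proof (rule summable_comparison_test_ev[rotated])
      show "\<forall>\<^sub>F m in sequentially. norm (size_fps $ Suc m * z ^ Suc m) \<le> z * sqrt y ^ m"
        using eventually_ge_at_top[of 1]
      proof eventually_elim
        case (elim m)
        have "size_fps $ Suc m * z ^ Suc m \<le> y ^ m * z ^ Suc m"
          using z less[OF elim] by (intro mult_right_mono) auto
        also have "\<dots> = z * sqrt y ^ m" by (simp flip: yz add: power_mult_distrib)
        finally show ?case using z size_fps_nonneg by simp
      qed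
    qed
    then have "summable (\<lambda>m. size_fps $ m * z ^ m)" 
      by (rule summable_Suc_iff[THEN iffD1])
    then show False using size_fps_not_summable[OF int \<kappa> heavy \<open>1 < z\<close>] by blast
  qed
  then obtain m where "1 \<le> m" "y ^ m \<le> size_fps $ Suc m" by blast
  from supermultiplicative_lower_bound[OF size_fps_nonneg size_fps_supermultiplicative y this]
  obtain C where C: "C > 0" "\<And>n. 0 < size_fps $ Suc n \<Longrightarrow> C * y ^ n \<le> size_fps $ Suc n" by auto
  have "C * y ^ n \<le> M.prob (size_event n)" if "0 < M.prob (size_event n)" for n
  proof (cases n)
    case 0
    then show ?thesis using that size_fps_0 by (simp add: size_fps_nth)
  next
    case (Suc k)
    \<comment> \<open>The bound was obtained for the sequence shifted by one; as
      \<open>y < 1\<close>, undoing the shift only weakens it.\<close>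
    have "C * y ^ n \<le> C * y ^ k" using y C Suc by (intro mult_left_mono power_decreasing) auto
    also have "\<dots> \<le> size_fps $ n" using C(2)[of k] that Suc by (simp add: size_fps_nth)
    finally show ?thesis by (simp add: size_fps_nth)
  qed
  then show ?thesis using C(1) by blast
qed

end

section \<open>Growth below a vertex of maximal outdegree\<close>

definition cutoff :: "nat \<Rightarrow> nat \<Rightarrow> nat" where
  "cutoff K k = (if k \<le> K then k else 0)"

text \<open>
  The root keeps its label: it will be the vertex of maximal outdegree.
\<close>

definition truncate_labels :: "nat \<Rightarrow> (nat list \<Rightarrow> nat) \<Rightarrow> nat list \<Rightarrow> nat" where
  "truncate_labels K c u = (if u = [] then c u else cutoff K (c u))"

text \<open>\<open>G l\<close> may be a proper subset of the vertices at depth \<open>l\<close>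
  below \<open>v\<close>, because the truncated tree provides only some of them. The letter at
  position \<open>length v\<close> names the child of \<open>v\<close> whose branch contains
  \<open>x\<close>.\<close>

definition spread_below :: "utree \<Rightarrow> nat list \<Rightarrow> (nat \<Rightarrow> real) \<Rightarrow> real \<Rightarrow> nat \<Rightarrow> bool" where
  "spread_below T v g \<delta> L \<longleftrightarrow> (\<exists>G. \<forall>l\<in>{1..L}.
     G l \<subseteq> T \<inter> {v @ u | u. length u = l} \<and>
     (g l - \<delta>) * real (card T) \<le> real (card (G l)) \<and>
     (\<forall>i. real (card {x \<in> G l. x ! length v = i}) \<le> \<delta> * real (card T)))"

lemma truncate_labels_le: "truncate_labels K c u \<le> c u"
  by (simp add: truncate_labels_def cutoff_def)

lemma card_generation_truncate_1: "card (generation 1 (truncate_labels K c)) = c []"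
  using card_generation_Suc[of 0 "truncate_labels K c"] by (simp add: truncate_labels_def)

lemma card_generation_truncate_Suc:
  assumes "1 \<le> l"
  shows "card (generation (Suc l) (truncate_labels K c)) = (\<Sum>u\<in>generation l (truncate_labels K c). cutoff K (c u))"
  unfolding card_generation_Suc using assms
  by (intro sum.cong) (auto simp: truncate_labels_def generation_def)

text \<open>Below the child \<open>[i]\<close> every truncated label is at most \<open>K\<close>,
  and \<open>l - 1\<close> steps remain. The root's untruncated label does not enter.\<close>

lemma card_generation_truncate_branch:
  assumes "1 \<le> l"
  shows "card {u \<in> generation l (truncate_labels K c). u ! 0 = i} \<le> K ^ (l - 1)"
proof -
  obtain j where j: "l = Suc j" using assms by (cases l) auto
  have "{u \<in> generation l (truncate_labels K c). u ! 0 = i} \<subseteq>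
      (#) i ` generation j (subtree_labels [i] (truncate_labels K c))"
    by (auto simp: j generation_Suc)
  then have "card {u \<in> generation l (truncate_labels K c). u ! 0 = i} \<le>
      card ((#) i ` generation j (subtree_labels [i] (truncate_labels K c)))"
    by (intro card_mono) auto
  also have "\<dots> = card (generation j (subtree_labels [i] (truncate_labels K c)))"
    by (simp add: card_image)
  also have "\<dots> \<le> K ^ j"
    by (intro card_generation_le) (simp add: truncate_labels_def cutoff_def)
  finally show ?thesis by (simp add: j)
qed

text \<open>Only generations with at least \<open>a\<close> vertices count, which is what makes the
  probability exponentially small in \<open>a\<close>.\<close>

definition slow_growth :: "nat \<Rightarrow> real \<Rightarrow> real \<Rightarrow> nat \<Rightarrow> (nat list \<Rightarrow> nat) set" where
  "slow_growth K r a l = {c. a \<le> real (card (generation l (truncate_labels K c))) \<and>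
     real (card (generation (Suc l) (truncate_labels K c))) < r * real (card (generation l (truncate_labels K c)))}"

lemma card_generation_truncate_ge:
  assumes s: "0 \<le> s" and r: "0 \<le> r" "r \<le> 1" and root: "s * n \<le> real (c [])" and "0 \<le> n"
    and fast: "\<And>l. l \<in> {1..<L} \<Longrightarrow> c \<notin> slow_growth K r (s * r ^ L * n) l"
    and l: "1 \<le> l" "l \<le> L"
  shows "s * r ^ (l - 1) * n \<le> real (card (generation l (truncate_labels K c)))"
  using l
proof (induction l rule: dec_induct)
  case base
  then show ?case using root by (simp add: card_generation_truncate_1[simplified])
next
  case (step l)
  have IH: "s * r ^ (l - 1) * n \<le> real (card (generation l (truncate_labels K c)))"
    using step by simp
  \<comment> \<open>The lower bound at every level up to \<open>L\<close> stays above the common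
    threshold \<open>s * r ^ L * n\<close>, so fast growth may be used at each step.\<close>
  have "r ^ L \<le> r ^ (l - 1)" using r step by (intro power_decreasing) auto
  then have "s * r ^ L * n \<le> s * r ^ (l - 1) * n"
    using s \<open>0 \<le> n\<close> by (intro mult_right_mono mult_left_mono)
  then have "r * real (card (generation l (truncate_labels K c))) \<le> real (card (generation (Suc l) (truncate_labels K c)))"
    using fast[of l] step IH by (auto simp: slow_growth_def)
  moreover have "r * (s * r ^ (l - 1) * n) \<le> r * real (card (generation l (truncate_labels K c)))"
    using IH r by (intro mult_left_mono)
  moreover have "r * (s * r ^ (l - 1) * n) = s * r ^ (Suc l - 1) * n"
    using step by (cases l) auto
  ultimately show ?case by linarith
qed

text \<open>The deterministic part: truncation only lowers labels, so the truncated descendants of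
  \<open>v\<close> are vertices of the tree. Hypothesis \<open>g\<close> compares the guaranteed
  proportions with the target ones, and hypothesis \<open>K\<close> makes \<open>n\<close> large
  enough for the branch bound.\<close>

lemma spread_below_family_tree:
  assumes fin: "finite (family_tree c)" and n: "card (family_tree c) = n" and v: "v \<in> family_tree c"
    and s: "0 \<le> s" and r: "0 \<le> r" "r \<le> 1" and deg: "s * real n \<le> real (c v)"
    and fast: "\<And>l. l \<in> {1..<L} \<Longrightarrow> subtree_labels v c \<notin> slow_growth K r (s * r ^ L * real n) l"
    and g: "\<And>l. l \<in> {1..L} \<Longrightarrow> g l - \<delta> \<le> s * r ^ (l - 1)"
    and K: "\<And>l. l \<in> {1..L} \<Longrightarrow> real (K ^ (l - 1)) \<le> \<delta> * real n"
  shows "spread_below (family_tree c) v g \<delta> L"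
proof -
  define G where "G l = (@) v ` generation l (truncate_labels K (subtree_labels v c))" for l
  have "G l \<subseteq> family_tree c \<inter> {v @ u | u. length u = l} \<and>
     (g l - \<delta>) * real n \<le> real (card (G l)) \<and>
     (\<forall>i. real (card {x \<in> G l. x ! length v = i}) \<le> \<delta> * real n)" if l: "l \<in> {1..L}" for l
  proof (intro conjI allI)
    have "generation l (truncate_labels K (subtree_labels v c)) \<subseteq> family_tree (subtree_labels v c)"
      using family_tree_mono[of "truncate_labels K (subtree_labels v c)" "subtree_labels v c", OF truncate_labels_le]
      unfolding generation_def by blast
    then have sub: "v @ u \<in> family_tree c" if "u \<in> generation l (truncate_labels K (subtree_labels v c))" for u
      using that v unfolding family_tree_append_iff by blast
    then show "G l \<subseteq> family_tree c \<inter> {v @ u | u. length u = l}"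
      unfolding G_def generation_def by blast
    have "(g l - \<delta>) * real n \<le> s * r ^ (l - 1) * real n"
      using g[OF l] by (intro mult_right_mono) auto
    also have "\<dots> \<le> real (card (generation l (truncate_labels K (subtree_labels v c))))"
      by (rule card_generation_truncate_ge[OF s r _ _ fast]) (use deg l in auto)
    also have "\<dots> = real (card (G l))"
      by (simp add: G_def card_image inj_on_def)
    finally show "(g l - \<delta>) * real n \<le> real (card (G l))" .
    fix i
    have "{x \<in> G l. x ! length v = i} \<subseteq> (@) v ` {u \<in> generation l (truncate_labels K (subtree_labels v c)). u ! 0 = i}"
      unfolding G_def by (auto simp: nth_append)
    then have "card {x \<in> G l. x ! length v = i} \<le> card ((@) v ` {u \<in> generation l (truncate_labels K (subtree_labels v c)). u ! 0 = i})"
      by (rule card_mono[rotated]) simp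
    also have "\<dots> = card {u \<in> generation l (truncate_labels K (subtree_labels v c)). u ! 0 = i}"
      by (simp add: card_image inj_on_def)
    also have "\<dots> \<le> K ^ (l - 1)"
      using l by (intro card_generation_truncate_branch) auto
    finally have "real (card {x \<in> G l. x ! length v = i}) \<le> real (K ^ (l - 1))"
      by (simp only: of_nat_le_iff)
    then show "real (card {x \<in> G l. x ! length v = i}) \<le> \<delta> * real n"
      using K[OF l] by linarith
  qed
  then show ?thesis unfolding spread_below_def n by blast
qed

context
  fixes \<zeta> :: "nat pmf"
begin

interpretation M: prob_space "offspring_space \<zeta>"
  unfolding offspring_space_def by (rule prob_space_PiM_pmf)

lemma measurable_truncate_labels: "truncate_labels K \<in> measurable (offspring_space \<zeta>) (offspring_space \<zeta>)"
proof (rule measurable_into_offspring)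
  fix u
  show "(\<lambda>c. truncate_labels K c u) \<in> measurable (offspring_space \<zeta>) (count_space UNIV)"
    unfolding truncate_labels_def
    by (rule measurable_compose[OF measurable_label[where u = u and \<zeta> = \<zeta>]]) simp
qed

lemma sets_slow_growth: "slow_growth K r a l \<in> sets (offspring_space \<zeta>)"
proof -
  define X where "X j c = real (card (generation j (truncate_labels K c)))" for j c
  have "(\<lambda>c. card (generation j (truncate_labels K c))) \<in> measurable (offspring_space \<zeta>) (count_space UNIV)" for j
    by (rule measurable_compose[OF measurable_truncate_labels measurable_card_generation])
  then have X: "X j \<in> borel_measurable (offspring_space \<zeta>)" for j
    unfolding X_def by (rule measurable_compose) simp
  have "slow_growth K r a l = {c \<in> space (offspring_space \<zeta>). a \<le> X l c} \<inter>
      {c \<in> space (offspring_space \<zeta>). X (Suc l) c < r * X l c}"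
    by (auto simp: slow_growth_def X_def)
  also have "\<dots> \<in> sets (offspring_space \<zeta>)"
    by (intro sets.Int borel_measurable_le borel_measurable_less X borel_measurable_const borel_measurable_times)
  finally show ?thesis .
qed

lemma sets_generation_truncate_eq: "{c. generation l (truncate_labels K c) = S} \<in> sets (offspring_space \<zeta>)"
proof -
  have "{c \<in> space (offspring_space \<zeta>). u \<in> generation l (truncate_labels K c)} \<in> sets (offspring_space \<zeta>)" for u
    using measurable_compose[OF measurable_truncate_labels pred_generation[where u = u and l = l and \<zeta> = \<zeta>], of K]
    by (simp add: pred_def)
  then have pos: "{c. u \<in> generation l (truncate_labels K c)} \<in> sets (offspring_space \<zeta>)" for u
    by simp
  have neg: "- {c. u \<in> generation l (truncate_labels K c)} \<in> sets (offspring_space \<zeta>)" for u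
    using sets.compl_sets[OF pos[of u]] by (simp add: Compl_eq_Diff_UNIV)
  have "{c. generation l (truncate_labels K c) = S} =
      (\<Inter>u. if u \<in> S then {c. u \<in> generation l (truncate_labels K c)} else - {c. u \<in> generation l (truncate_labels K c)})"
    by (auto split: if_splits)
  also have "\<dots> \<in> sets (offspring_space \<zeta>)"
    by (intro sets.countable_INT'') (use pos neg in \<open>auto simp: sets.top[of "offspring_space \<zeta>", simplified]\<close>)
  finally show ?thesis .
qed

text \<open>Whether a word of length \<open>l\<close> is born is decided by its proper prefixes, so
  the labels at level \<open>l\<close> itself remain independent of the generation.\<close>

lemma depends_only_on_generation_truncate_eq:
  "depends_only_on {u. length u < l} {c. generation l (truncate_labels K c) = S}"
proof -
  have eq: "generation l (truncate_labels K c) = generation l (truncate_labels K c')"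
    if c: "\<forall>i\<in>{u. length u < l}. c i = c' i" for c c'
  proof -
    have "truncate_labels K c (take i u) = truncate_labels K c' (take i u)" if "length u = l" "i < l" for u i
      using c that by (simp add: truncate_labels_def)
    then have "u \<in> family_tree (truncate_labels K c) \<longleftrightarrow> u \<in> family_tree (truncate_labels K c')" if "length u = l" for u
      unfolding family_tree_iff using that by simp
    then show ?thesis unfolding generation_def by blast
  qed
  show ?thesis unfolding depends_only_on_def using eq by blast
qed

lemma expectation_label:
  fixes f :: "nat \<Rightarrow> real"
  shows "M.expectation (\<lambda>c. f (c u)) = measure_pmf.expectation \<zeta> f"
proof -
  have "measure_pmf.expectation \<zeta> f = integral\<^sup>L (distr (offspring_space \<zeta>) (measure_pmf \<zeta>) (\<lambda>c. c u)) f"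
    unfolding offspring_space_def by (subst distr_PiM_component) (auto simp: measure_pmf.prob_space_axioms)
  also have "\<dots> = M.expectation (\<lambda>c. f (c u))"
    using measurable_label[of u \<zeta>] by (intro integral_distr) auto
  finally show ?thesis ..
qed

text \<open>Hoeffding's inequality for summands between 0 and \<open>K\<close>, at deviation
  \<open>card S * (\<mu> - r)\<close> from the mean.\<close>

lemma prob_sum_cutoff_le:
  assumes S: "finite S" and r: "0 \<le> r" "r < measure_pmf.expectation \<zeta> (\<lambda>k. real (cutoff K k))"
  shows "M.prob {c. (\<Sum>u\<in>S. real (cutoff K (c u))) \<le> r * real (card S)}
    \<le> exp (- (2 * (measure_pmf.expectation \<zeta> (\<lambda>k. real (cutoff K k)) - r)\<^sup>2 / (real K)\<^sup>2) * real (card S))"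
proof (cases "S = {}")
  case True
  then show ?thesis by simp
next
  case False
  define \<mu> where "\<mu> = measure_pmf.expectation \<zeta> (\<lambda>k. real (cutoff K k))"
  have card: "0 < card S" using S False by (simp add: card_gt_0_iff)
  \<comment> \<open>Needed because \<open>K\<close> occurs in the denominator of the exponent; for
    \<open>K = 0\<close> the truncated mean would be 0 and could not exceed
    \<open>r\<close>.\<close>
  have "K \<noteq> 0"
  proof
    assume "K = 0"
    then have "cutoff K k = 0" for k by (simp add: cutoff_def)
    then show False using r by simp
  qed
  have ind: "M.indep_vars (\<lambda>_. borel) (\<lambda>u c. real (cutoff K (c u))) S"
  proof (rule M.indep_vars_subset)
    show "M.indep_vars (\<lambda>_. borel) (\<lambda>u c. real (cutoff K (c u))) UNIV"
      unfolding offspring_space_def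
      by (rule prob_space.indep_vars_compose2[OF prob_space_PiM_pmf indep_vars_PiM_pmf]) simp
  qed simp
  interpret H: Hoeffding_ineq "offspring_space \<zeta>" S "\<lambda>u c. real (cutoff K (c u))" "\<lambda>_. 0" "\<lambda>_. real K"
      "\<Sum>u\<in>S. M.expectation (\<lambda>c. real (cutoff K (c u)))"
    by unfold_locales (use S ind in \<open>auto simp: cutoff_def\<close>)
  have sum: "(\<Sum>u\<in>S. M.expectation (\<lambda>c. real (cutoff K (c u)))) = real (card S) * \<mu>"
    by (simp add: expectation_label[of "\<lambda>k. real (cutoff K k)"] \<mu>_def)
  have "M.prob {c \<in> space (offspring_space \<zeta>). (\<Sum>u\<in>S. real (cutoff K (c u))) \<le>
      (\<Sum>u\<in>S. M.expectation (\<lambda>c. real (cutoff K (c u)))) - real (card S) * (\<mu> - r)}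
      \<le> exp (- 2 * (real (card S) * (\<mu> - r))\<^sup>2 / (\<Sum>u\<in>S. (real K - 0)\<^sup>2))"
    by (rule H.Hoeffding_ineq_le) (use card \<open>K \<noteq> 0\<close> r in \<open>auto simp: \<mu>_def\<close>)
  also have "- 2 * (real (card S) * (\<mu> - r))\<^sup>2 / (\<Sum>u\<in>S. (real K - 0)\<^sup>2) =
      - (2 * (\<mu> - r)\<^sup>2 / (real K)\<^sup>2) * real (card S)"
    using card \<open>K \<noteq> 0\<close> by (simp add: power_mult_distrib power2_eq_square divide_simps)
  also have "(\<Sum>u\<in>S. M.expectation (\<lambda>c. real (cutoff K (c u)))) - real (card S) * (\<mu> - r) = r * real (card S)"
    unfolding sum by (simp add: algebra_simps)
  finally show ?thesis by (simp add: \<mu>_def)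
qed

text \<open>Given that the truncated generation \<open>l\<close> is \<open>S\<close>, the labels on
  \<open>S\<close> are still independent with law \<zeta>, so Hoeffding's bound holds with
  \<open>card S\<close> in the exponent. Since \<open>card S\<close> is at least \<open>a\<close>,
  it is uniform in \<open>S\<close>.\<close>

lemma prob_slow_growth:
  assumes l: "1 \<le> l" and r: "0 \<le> r" "r < measure_pmf.expectation \<zeta> (\<lambda>k. real (cutoff K k))"
  shows "M.prob (slow_growth K r a l)
    \<le> exp (- (2 * (measure_pmf.expectation \<zeta> (\<lambda>k. real (cutoff K k)) - r)\<^sup>2 / (real K)\<^sup>2) * a)"
proof -
  define \<eta> where "\<eta> = 2 * (measure_pmf.expectation \<zeta> (\<lambda>k. real (cutoff K k)) - r)\<^sup>2 / (real K)\<^sup>2"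
  have \<eta>: "0 \<le> \<eta>" by (simp add: \<eta>_def)
  \<comment> \<open>There are only countably many finite sets of words, so the possible values
    \<open>S\<close> of the generation can be summed over.\<close>
  define I where "I = {S. finite S \<and> S \<subseteq> {u :: nat list. length u = l} \<and> a \<le> real (card S)}"
  define E where "E S = {c. generation l (truncate_labels K c) = S}" for S
  define F where "F S = {c. (\<Sum>u\<in>S. real (cutoff K (c u))) \<le> r * real (card S)}" for S :: "nat list set"
  have F: "F S \<in> sets (offspring_space \<zeta>)" for S
  proof -
    have "(\<lambda>c. \<Sum>u\<in>S. real (cutoff K (c u))) \<in> borel_measurable (offspring_space \<zeta>)"
      by (intro borel_measurable_sum measurable_compose[OF measurable_label]) simp
    then have "{c \<in> space (offspring_space \<zeta>). (\<Sum>u\<in>S. real (cutoff K (c u))) \<le> r * real (card S)} \<in> sets (offspring_space \<zeta>)"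
      by measurable
    then show ?thesis by (simp add: F_def)
  qed
  have E: "E S \<in> sets (offspring_space \<zeta>)" for S
    unfolding E_def by (rule sets_generation_truncate_eq)
  have "slow_growth K r a l \<subseteq> (\<Union>S\<in>I. E S \<inter> F S)"
  proof
    fix c assume c: "c \<in> slow_growth K r a l"
    let ?S = "generation l (truncate_labels K c)"
    have "?S \<subseteq> {u. length u = l}" by (auto simp: generation_def)
    then have "?S \<in> I" using c by (simp add: I_def slow_growth_def)
    moreover have "c \<in> F ?S"
      using c by (simp add: slow_growth_def F_def card_generation_truncate_Suc[OF l])
    ultimately show "c \<in> (\<Union>S\<in>I. E S \<inter> F S)" by (auto simp: E_def)
  qed
  then have "M.prob (slow_growth K r a l) \<le> M.prob (\<Union>S\<in>I. E S \<inter> F S)"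
  proof (rule M.finite_measure_mono)
    have "countable I" by (rule countable_subset[OF _ countable_Collect_finite]) (auto simp: I_def)
    then show "(\<Union>S\<in>I. E S \<inter> F S) \<in> sets (offspring_space \<zeta>)"
      by (rule sets.countable_UN') (use E F in auto)
  qed
  also have "\<dots> \<le> exp (- \<eta> * a)"
  proof (rule M.prob_UN_disjoint_le)
    show "countable I" by (rule countable_subset[OF _ countable_Collect_finite]) (auto simp: I_def)
    show "disjoint_family_on E I" by (auto simp: disjoint_family_on_def E_def)
    fix S assume S: "S \<in> I"
    have "depends_only_on S (F S)"
    proof -
      have "(\<Sum>u\<in>S. real (cutoff K (c u))) = (\<Sum>u\<in>S. real (cutoff K (c' u)))"
        if "\<forall>i\<in>S. c i = c' i" for c c' :: "nat list \<Rightarrow> nat"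
        using that by (intro sum.cong) auto
      then show ?thesis unfolding depends_only_on_def F_def by simp
    qed
    then have "M.prob (E S \<inter> F S) = M.prob (E S) * M.prob (F S)"
      by (rule prob_Int_disjoint_labels[OF E depends_only_on_generation_truncate_eq[of l K S, folded E_def] F])
         (use S in \<open>auto simp: I_def\<close>)
    moreover have "M.prob (F S) \<le> exp (- \<eta> * a)"
    proof -
      have "M.prob (F S) \<le> exp (- \<eta> * real (card S))"
        unfolding F_def \<eta>_def by (rule prob_sum_cutoff_le[OF _ r]) (use S in \<open>simp add: I_def\<close>)
      moreover have "\<eta> * a \<le> \<eta> * real (card S)"
        by (rule mult_left_mono) (use S \<eta> in \<open>simp_all add: I_def\<close>)
      then have "exp (- \<eta> * real (card S)) \<le> exp (- \<eta> * a)" by simp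
      ultimately show ?thesis by linarith
    qed
    ultimately show "M.prob (E S \<inter> F S) \<le> exp (- \<eta> * a) * M.prob (E S)"
      by (simp only: mult.commute[of "M.prob (E S)"]) (rule mult_right_mono, simp_all)
  qed (use E F in auto)
  finally show ?thesis by (simp only: \<eta>_def)
qed

section \<open>The conditioned law\<close>

lemma sets_family_tree_eq: "{c. family_tree c = t} \<in> sets (offspring_space \<zeta>)"
proof -
  have pos: "{c. u \<in> family_tree c} \<in> sets (offspring_space \<zeta>)" for u
    using pred_family_tree[where u = u and \<zeta> = \<zeta>] by (simp add: pred_def)
  have neg: "- {c. u \<in> family_tree c} \<in> sets (offspring_space \<zeta>)" for u
    using sets.compl_sets[OF pos[of u]] by (simp add: Compl_eq_Diff_UNIV)
  have "{c. family_tree c = t} = (\<Inter>u. if u \<in> t then {c. u \<in> family_tree c} else - {c. u \<in> family_tree c})"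
    by (auto split: if_splits)
  also have "\<dots> \<in> sets (offspring_space \<zeta>)"
    by (intro sets.countable_INT'') (use pos neg in \<open>auto simp: sets.top[of "offspring_space \<zeta>", simplified]\<close>)
  finally show ?thesis .
qed

text \<open>\<open>A\<close> can be any set of trees: only countably many trees have
  \<open>n\<close> vertices, and each is the family tree on a measurable event.\<close>

lemma sets_size_event_family_tree: "{c \<in> size_event n. family_tree c \<in> A} \<in> sets (offspring_space \<zeta>)"
proof -
  let ?I = "{t \<in> A. finite t \<and> card t = n}"
  have "{c \<in> size_event n. family_tree c \<in> A} = (\<Union>t\<in>?I. {c. family_tree c = t})"
    by (auto simp: size_event_def)
  moreover have "countable ?I" by (rule countable_subset[OF _ countable_Collect_finite]) auto
  ultimately show ?thesis
    using sets.countable_UN'[of ?I "\<lambda>t. {c. family_tree c = t}" "offspring_space \<zeta>"] sets_family_tree_eq by auto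
qed

lemma measurable_family_tree_restrict:
  "family_tree \<in> measurable (restrict_space (uniform_measure (offspring_space \<zeta>) (size_event n)) (size_event n)) (count_space UNIV)"
proof (rule measurableI)
  let ?R = "restrict_space (uniform_measure (offspring_space \<zeta>) (size_event n)) (size_event n)"
  fix B :: "utree set"
  have "family_tree -` B \<inter> space ?R = {c \<in> size_event n. family_tree c \<in> B}"
    by (auto simp: space_restrict_space)
  moreover have "{c \<in> size_event n. family_tree c \<in> B} \<in> sets ?R"
    using sets_size_event_family_tree by (subst sets_restrict_space_iff) auto
  ultimately show "family_tree -` B \<inter> space ?R \<in> sets ?R"
    by simp
qed simp

lemma prob_space_conditioned_GW:
  assumes "0 < M.prob (size_event n)"
  shows "prob_space (conditioned_GW \<zeta> n)"
proof -
  let ?U = "uniform_measure (offspring_space \<zeta>) (size_event n)"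
  have pos: "emeasure (offspring_space \<zeta>) (size_event n) \<noteq> 0" "emeasure (offspring_space \<zeta>) (size_event n) \<noteq> \<infinity>"
    using assms by (simp_all add: M.emeasure_eq_measure)
  have "emeasure ?U (size_event n) = 1"
    using pos by (rule emeasure_uniform_measure_1)
  then have "prob_space (restrict_space ?U (size_event n))"
    using prob_space_uniform_measure[OF pos] sets_size_event by (intro prob_space_restrict_space) auto
  then show ?thesis
    unfolding conditioned_GW_def by (rule prob_space.prob_space_distr[OF _ measurable_family_tree_restrict])
qed

lemma space_conditioned_GW [simp]: "space (conditioned_GW \<zeta> n) = UNIV"
  and sets_conditioned_GW [simp]: "sets (conditioned_GW \<zeta> n) = UNIV"
  by (simp_all add: conditioned_GW_def)

lemma measure_conditioned_GW:
  assumes "0 < M.prob (size_event n)"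
  shows "measure (conditioned_GW \<zeta> n) A = M.prob {c \<in> size_event n. family_tree c \<in> A} / M.prob (size_event n)"
proof -
  let ?U = "uniform_measure (offspring_space \<zeta>) (size_event n)"
  have S: "size_event n \<inter> space ?U \<in> sets ?U" by simp
  have "measure (conditioned_GW \<zeta> n) A = measure (restrict_space ?U (size_event n)) {c \<in> size_event n. family_tree c \<in> A}"
    unfolding conditioned_GW_def
    by (subst measure_distr[OF measurable_family_tree_restrict]) (auto simp: space_restrict_space intro!: arg_cong2[where f = measure])
  also have "\<dots> = measure ?U {c \<in> size_event n. family_tree c \<in> A}"
    by (rule measure_restrict_space[OF S]) auto
  also have "\<dots> = M.prob (size_event n \<inter> {c \<in> size_event n. family_tree c \<in> A}) / M.prob (size_event n)"
    using assms by (intro measure_uniform_measure) (auto simp: M.emeasure_eq_measure sets_size_event_family_tree)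
  also have "size_event n \<inter> {c \<in> size_event n. family_tree c \<in> A} = {c \<in> size_event n. family_tree c \<in> A}" by auto
  finally show ?thesis .
qed

lemma eventually_GW_sizes:
  "eventually P (GW_sizes \<zeta>) \<longleftrightarrow> eventually (\<lambda>n. 0 < M.prob (size_event n) \<longrightarrow> P n) sequentially"
  unfolding GW_sizes_def eventually_inf_principal by simp

lemma expectation_cutoff_tendsto:
  assumes "integrable (measure_pmf \<zeta>) real"
  shows "(\<lambda>K. measure_pmf.expectation \<zeta> (\<lambda>k. real (cutoff K k))) \<longlonglongrightarrow> measure_pmf.expectation \<zeta> real"
proof (rule integral_dominated_convergence[where w = real])
  show "AE k in measure_pmf \<zeta>. (\<lambda>K. real (cutoff K k)) \<longlonglongrightarrow> real k"
  proof (rule AE_I2)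
    fix k
    have "eventually (\<lambda>K. real (cutoff K k) = real k) sequentially"
      using eventually_ge_at_top[of k] by eventually_elim (simp add: cutoff_def)
    then show "(\<lambda>K. real (cutoff K k)) \<longlonglongrightarrow> real k" by (rule tendsto_eventually)
  qed
qed (use assms in \<open>auto simp: cutoff_def\<close>)

text \<open>Either some vertex of the tree has slow growth below it, which has negligible
  probability even after conditioning, or the vertex of maximal outdegree satisfies the hypotheses
  of \<open>spread_below_family_tree\<close>.\<close>

theorem conditioned_GW_spread_below:
  fixes \<kappa> :: real
  assumes int: "integrable (measure_pmf \<zeta>) real" and \<kappa>_def: "\<kappa> = measure_pmf.expectation \<zeta> real"
    and \<kappa>: "0 < \<kappa>" "\<kappa> < 1"
    and heavy: "\<And>R :: real. R > 1 \<Longrightarrow> (\<integral>\<^sup>+k. ennreal (R ^ k) \<partial>measure_pmf \<zeta>) = \<infinity>"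
    and conv: "converges_in_prob euclideanreal (conditioned_GW \<zeta>)
           (\<lambda>n T. real (max_outdegree T) / real n) (1 - \<kappa>) (GW_sizes \<zeta>)"
    and \<delta>: "0 < \<delta>"
  shows "((\<lambda>n. measure (conditioned_GW \<zeta> n)
      {T \<in> range family_tree. finite T \<and> card T = n \<and> (\<exists>v. spread_below T v (\<lambda>l. (1 - \<kappa>) * \<kappa> ^ (l - 1)) \<delta> L)}) \<longlongrightarrow> 1) (GW_sizes \<zeta>)"
proof -
  let ?g = "\<lambda>l. (1 - \<kappa>) * \<kappa> ^ (l - 1)"
  define A where "A n = {T \<in> range family_tree. finite T \<and> card T = n \<and> (\<exists>v. spread_below T v ?g \<delta> L)}" for n
  \<comment> \<open>As \<open>r\<close> increases to \<kappa>, the factor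
    \<open>1 - 2 * \<kappa> + r\<close> increases to \<open>1 - \<kappa>\<close>, so one parameter
    yields both a growth rate below \<kappa> and an outdegree proportion below
    \<open>1 - \<kappa>\<close>. The slack \<delta> is enough for the finitely many levels.\<close>
  have "eventually (\<lambda>r. \<forall>l\<in>{1..L}. ?g l - \<delta> < (1 - 2 * \<kappa> + r) * r ^ (l - 1)) (at_left \<kappa>)"
  proof (intro eventually_ball_finite ballI)
    fix l
    have "((\<lambda>r. (1 - 2 * \<kappa> + r) * r ^ (l - 1)) \<longlongrightarrow> (1 - 2 * \<kappa> + \<kappa>) * \<kappa> ^ (l - 1)) (at_left \<kappa>)"
      by (intro tendsto_intros)
    moreover have "?g l - \<delta> < (1 - 2 * \<kappa> + \<kappa>) * \<kappa> ^ (l - 1)" using \<delta> by simp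
    ultimately show "eventually (\<lambda>r. ?g l - \<delta> < (1 - 2 * \<kappa> + r) * r ^ (l - 1)) (at_left \<kappa>)"
      by (rule order_tendstoD(1))
  qed simp
  moreover have "eventually (\<lambda>r. 0 < r \<and> 2 * \<kappa> - 1 < r \<and> r < \<kappa>) (at_left \<kappa>)"
    unfolding eventually_at_left_field using \<kappa> by (intro exI[of _ "max 0 (2 * \<kappa> - 1)"]) auto
  ultimately have "eventually (\<lambda>r. (\<forall>l\<in>{1..L}. ?g l - \<delta> < (1 - 2 * \<kappa> + r) * r ^ (l - 1)) \<and>
      (0 < r \<and> 2 * \<kappa> - 1 < r \<and> r < \<kappa>)) (at_left \<kappa>)"
    by (rule eventually_conj)
  from eventually_happens'[OF trivial_limit_at_left_real this]
  obtain r where r: "0 < r" "2 * \<kappa> - 1 < r" "r < \<kappa>"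
      and g: "\<And>l. l \<in> {1..L} \<Longrightarrow> ?g l - \<delta> < (1 - 2 * \<kappa> + r) * r ^ (l - 1)"
    by blast
  define s where "s = 1 - 2 * \<kappa> + r"
  have s: "0 < s" "s < 1 - \<kappa>" using r by (auto simp: s_def)
  have "eventually (\<lambda>K. r < measure_pmf.expectation \<zeta> (\<lambda>k. real (cutoff K k))) sequentially"
    using expectation_cutoff_tendsto[OF int] r by (intro order_tendstoD(1)) (auto simp: \<kappa>_def)
  from eventually_happens'[OF sequentially_bot this]
  obtain K where K: "r < measure_pmf.expectation \<zeta> (\<lambda>k. real (cutoff K k))" ..
  have "K \<noteq> 0"
  proof
    assume "K = 0"
    then have "cutoff K k = 0" for k by (simp add: cutoff_def)
    then show False using r K by simp
  qed
  define \<eta> where "\<eta> = 2 * (measure_pmf.expectation \<zeta> (\<lambda>k. real (cutoff K k)) - r)\<^sup>2 / (real K)\<^sup>2"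
  have \<eta>: "0 < \<eta>" using K \<open>K \<noteq> 0\<close> by (simp add: \<eta>_def)
  \<comment> \<open>Half of the exponent that \<open>prob_slow_growth\<close> gives at threshold
    \<open>s * r ^ L * n\<close>, so that this probability is \<open>y ^ (2 * n)\<close>.\<close>
  define \<beta> where "\<beta> = \<eta> * (s * r ^ L) / 2"
  have \<beta>: "0 < \<beta>" using \<eta> s r by (simp add: \<beta>_def)
  define y where "y = exp (- \<beta>)"
  have "0 < y" "y < 1" using \<beta> by (auto simp: y_def)
  from size_prob_lower_bound[OF int \<kappa>(2)[unfolded \<kappa>_def] heavy this]
  obtain C where C: "0 < C" "\<And>n. 0 < M.prob (size_event n) \<Longrightarrow> C * y ^ n \<le> M.prob (size_event n)"
    by blast
  define D where "D n = {T. real (max_outdegree T) / real n \<in> {s<..}}" for n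
  define err where "err n = real L / ((1 - \<kappa>) * C) * y ^ n" for n
  define B where "B n = (\<Union>l\<in>{1..<L}. slow_growth K r (s * r ^ L * real n) l)" for n
  have B: "B n \<in> sets (offspring_space \<zeta>)" for n
    unfolding B_def using sets_slow_growth by (intro sets.finite_UN) auto
  have prob_B: "M.prob (B n) \<le> real L * y ^ (2 * n)" for n
  proof -
    have "M.prob (B n) \<le> (\<Sum>l\<in>{1..<L}. M.prob (slow_growth K r (s * r ^ L * real n) l))"
      unfolding B_def using sets_slow_growth by (intro M.finite_measure_subadditive_finite) auto
    also have "\<dots> \<le> (\<Sum>l\<in>{1..<L}. exp (- \<eta> * (s * r ^ L * real n)))"
      unfolding \<eta>_def using r K by (intro sum_mono prob_slow_growth) auto
    also have "\<dots> \<le> real L * exp (- \<eta> * (s * r ^ L * real n))"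
      by (simp add: mult_right_mono)
    also have "exp (- \<eta> * (s * r ^ L * real n)) = y ^ (2 * n)"
      by (simp add: y_def \<beta>_def flip: exp_of_nat_mult)
    finally show ?thesis .
  qed
  \<comment> \<open>Bad growth below any vertex at all, because the vertex of maximal outdegree
    depends on the whole tree.\<close>
  define Bv where "Bv n = {c. \<exists>v\<in>family_tree c. subtree_labels v c \<in> B n}" for n
  have sets_Bv: "Bv n \<in> sets (offspring_space \<zeta>)" for n
  proof -
    have "Bv n = (\<Union>l. descendant_event l (B n))"
      by (auto simp: Bv_def descendant_event_def family_tree_UN_generation)
    also have "\<dots> \<in> sets (offspring_space \<zeta>)"
      by (intro sets.countable_UN') (use sets_descendant_event[OF B] in auto)
    finally show ?thesis .
  qed
  have prob_Bv: "M.prob (Bv n) \<le> real L * y ^ (2 * n) / (1 - \<kappa>)" for n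
  proof -
    have "M.prob (Bv n) \<le> M.prob (B n) / (1 - \<kappa>)"
      unfolding Bv_def \<kappa>_def by (rule prob_Union_descendant_event[OF int \<kappa>(2)[unfolded \<kappa>_def] B])
    also have "\<dots> \<le> real L * y ^ (2 * n) / (1 - \<kappa>)"
      using prob_B \<kappa> by (intro divide_right_mono) auto
    finally show ?thesis .
  qed
  have large: "eventually (\<lambda>n. \<forall>l\<in>{1..L}. real (K ^ (l - 1)) \<le> \<delta> * real n) sequentially"
  proof (intro eventually_ball_finite ballI)
    fix l
    show "eventually (\<lambda>n. real (K ^ (l - 1)) \<le> \<delta> * real n) sequentially"
      using filterlim_tendsto_pos_mult_at_top[OF tendsto_const \<delta> filterlim_real_sequentially]
      by (simp add: filterlim_at_top)
  qed simp
  have lower: "eventually (\<lambda>n. measure (conditioned_GW \<zeta> n) (D n) - err n \<le> measure (conditioned_GW \<zeta> n) (A n)) (GW_sizes \<zeta>)"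
    unfolding eventually_GW_sizes using large eventually_gt_at_top[of 0]
  proof eventually_elim
    case (elim n)
    show ?case
    proof
      assume pos: "0 < M.prob (size_event n)"
      have "{c \<in> size_event n. family_tree c \<in> D n} \<subseteq> {c \<in> size_event n. family_tree c \<in> A n} \<union> Bv n"
      proof (rule subsetI, rule UnCI)
        fix c assume c: "c \<in> {c \<in> size_event n. family_tree c \<in> D n}" and nB: "c \<notin> Bv n"
        then have fin: "finite (family_tree c)" and n: "card (family_tree c) = n"
          by (auto simp: size_event_def)
        obtain v where v: "v \<in> family_tree c" "max_outdegree (family_tree c) = c v"
          using max_outdegree_family_tree[OF fin] by blast
        have "s < real (c v) / real n" using c v by (simp add: D_def)
        then have deg: "s * real n \<le> real (c v)" using elim by (simp add: field_simps)
        have nB': "subtree_labels v c \<notin> slow_growth K r (s * r ^ L * real n) l" if "l \<in> {1..<L}" for l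
          using nB v that unfolding Bv_def B_def by blast
        have "spread_below (family_tree c) v ?g \<delta> L"
        proof (rule spread_below_family_tree[OF fin n v(1) _ _ _ deg nB'])
          show "?g l - \<delta> \<le> s * r ^ (l - 1)" if "l \<in> {1..L}" for l
            using g[OF that] by (simp add: s_def)
        qed (use s r \<kappa> elim in auto)
        then show "c \<in> {c \<in> size_event n. family_tree c \<in> A n}"
          using c fin n by (auto simp: A_def)
      qed
      then have "M.prob {c \<in> size_event n. family_tree c \<in> D n} \<le> M.prob ({c \<in> size_event n. family_tree c \<in> A n} \<union> Bv n)"
        by (rule M.finite_measure_mono[OF _ sets.Un[OF sets_size_event_family_tree sets_Bv]])
      also have "\<dots> \<le> M.prob {c \<in> size_event n. family_tree c \<in> A n} + M.prob (Bv n)"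
        by (rule measure_Un_le[OF sets_size_event_family_tree sets_Bv])
      finally have "M.prob {c \<in> size_event n. family_tree c \<in> D n} / M.prob (size_event n)
          \<le> (M.prob {c \<in> size_event n. family_tree c \<in> A n} + M.prob (Bv n)) / M.prob (size_event n)"
        by (rule divide_right_mono[OF _ measure_nonneg])
      moreover have "M.prob (Bv n) / M.prob (size_event n) \<le> err n"
      proof -
        \<comment> \<open>Conditioning costs at most the factor \<open>1 / (C * y ^ n)\<close>; one
          of the two factors \<open>y ^ n\<close> survives.\<close>
        have "M.prob (Bv n) / M.prob (size_event n) \<le> (real L * y ^ (2 * n) / (1 - \<kappa>)) / (C * y ^ n)"
          by (rule frac_le) (use prob_Bv[of n] C(1) C(2)[OF pos] \<kappa> \<open>0 < y\<close> in simp_all)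
        also have "\<dots> = err n"
          unfolding err_def mult_2 power_add using \<open>0 < y\<close> by simp
        finally show ?thesis .
      qed
      ultimately show "measure (conditioned_GW \<zeta> n) (D n) - err n \<le> measure (conditioned_GW \<zeta> n) (A n)"
        unfolding measure_conditioned_GW[OF pos] by (simp add: add_divide_distrib)
    qed
  qed
  have "((\<lambda>n. measure (conditioned_GW \<zeta> n) {T \<in> space (conditioned_GW \<zeta> n). real (max_outdegree T) / real n \<in> {s<..}}) \<longlongrightarrow> 1) (GW_sizes \<zeta>)"
  proof -
    have "openin euclideanreal {s<..}" "1 - \<kappa> \<in> {s<..}" using s by (simp_all add: open_openin[symmetric])
    then show ?thesis using conv unfolding converges_in_prob_def by blast
  qed
  then have "((\<lambda>n. measure (conditioned_GW \<zeta> n) (D n)) \<longlongrightarrow> 1) (GW_sizes \<zeta>)"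
    by (simp add: D_def)
  moreover have "(err \<longlongrightarrow> 0) (GW_sizes \<zeta>)"
  proof (rule filterlim_mono)
    have "(\<lambda>n. y ^ n) \<longlonglongrightarrow> 0" using \<open>0 < y\<close> \<open>y < 1\<close> by (intro LIMSEQ_power_zero) auto
    from tendsto_mult_right_zero[OF this] show "err \<longlonglongrightarrow> 0" unfolding err_def .
  qed (auto simp: GW_sizes_def)
  ultimately have lim: "((\<lambda>n. measure (conditioned_GW \<zeta> n) (D n) - err n) \<longlongrightarrow> 1) (GW_sizes \<zeta>)"
    using tendsto_diff[of "\<lambda>n. measure (conditioned_GW \<zeta> n) (D n)" 1 "GW_sizes \<zeta>" err 0] by simp
  have "eventually (\<lambda>n. measure (conditioned_GW \<zeta> n) (A n) \<le> 1) (GW_sizes \<zeta>)"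
    unfolding eventually_GW_sizes by (intro always_eventually allI impI prob_space.prob_le_1 prob_space_conditioned_GW)
  from tendsto_sandwich[OF lower this lim tendsto_const] show ?thesis
    unfolding A_def .
qed

end

section \<open>Distances through a common vertex\<close>

text \<open>
  The potential is the distance to \<open>v\<close> for the vertices that the path through \<open>v\<close> visits,
  with a minus sign unless they are in the branch \<open>j\<close> at \<open>v\<close>; it is 1-Lipschitz on all words.
\<close>

lemma tree_edges_potential:
  fixes v :: "nat list" and j :: nat
  defines "\<phi> \<equiv> \<lambda>u :: nat list. if take (Suc (length v)) u = v @ [j] then int (length u) - int (length v) else int (length v) - int (length u)"
  assumes "(a, b) \<in> tree_edges T ^^ k"
  shows "\<phi> b \<le> \<phi> a + int k"
  using assms(2)
proof (induction k arbitrary: b)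
  case (Suc k)
  then obtain c where c: "(a, c) \<in> tree_edges T ^^ k" and e: "(c, b) \<in> tree_edges T" by auto
  have snoc: "\<bar>\<phi> (u @ [i]) - \<phi> u\<bar> \<le> 1" for u i
  \<comment> \<open>Appending a letter can change the sign only at words as long as
    \<open>v\<close>, and there the potential is 0.\<close>
  proof (cases "length u = length v")
    case True
    then have "u \<noteq> v @ [j]" by auto
    with True show ?thesis by (simp add: \<phi>_def)
  next
    case False
    then have "take (Suc (length v)) (u @ [i]) = v @ [j] \<longleftrightarrow> take (Suc (length v)) u = v @ [j]"
    proof (cases "length v < length u")
      case False
      then have "length u < length v" using \<open>length u \<noteq> length v\<close> by simp
      then have "length (take (Suc (length v)) (u @ [i])) \<noteq> length (v @ [j])"
          "length (take (Suc (length v)) u) \<noteq> length (v @ [j])" by simp_all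
      then show ?thesis by metis
    qed simp
    then show ?thesis by (simp add: \<phi>_def)
  qed
  from e obtain i where "b = c @ [i] \<or> c = b @ [i]" by (auto simp: tree_edges_def)
  then have "\<phi> b \<le> \<phi> c + 1" using snoc[of c i] snoc[of b i] by auto
  then show ?case using Suc.IH[OF c] by simp
qed simp

lemma tree_edges_relpow_append:
  assumes closed: "\<And>u w. u @ w \<in> T \<Longrightarrow> u \<in> T" and "v @ w \<in> T"
  shows "(v, v @ w) \<in> tree_edges T ^^ length w" and "(v @ w, v) \<in> tree_edges T ^^ length w"
proof -
  have sym: "(b, a) \<in> tree_edges T" if "(a, b) \<in> tree_edges T" for a b
    using that by (auto simp: tree_edges_def)
  have "(v, v @ w) \<in> tree_edges T ^^ length w \<and> (v @ w, v) \<in> tree_edges T ^^ length w"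
    using assms(2)
  proof (induction w rule: rev_induct)
    case (snoc i w)
    have mem: "v @ w \<in> T" using closed[of "v @ w" "[i]"] snoc.prems by simp
    then have e: "(v @ w, v @ w @ [i]) \<in> tree_edges T"
      using snoc.prems by (auto simp: tree_edges_def)
    show ?case
      using snoc.IH[OF mem] e sym[OF e] relpow_Suc_I[of v "v @ w"] relpow_Suc_I2[OF sym[OF e]] by simp
  qed simp
  then show "(v, v @ w) \<in> tree_edges T ^^ length w" "(v @ w, v) \<in> tree_edges T ^^ length w" by auto
qed

text \<open>The path through \<open>v\<close> gives the upper bound. For the lower bound, the
  potential of the branch containing \<open>v @ y\<close> climbs from \<open>- length x\<close> to
  \<open>length y\<close>, by at most 1 per edge.\<close>

lemma tree_dist_branches:
  assumes closed: "\<And>u w. u @ w \<in> T \<Longrightarrow> u \<in> T"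
    and x: "v @ x \<in> T" "x \<noteq> []" and y: "v @ y \<in> T" "y \<noteq> []" and neq: "x ! 0 \<noteq> y ! 0"
  shows "tree_dist T (v @ x) (v @ y) = length x + length y"
  unfolding tree_dist_def
proof (rule Least_equality)
  show "(v @ x, v @ y) \<in> tree_edges T ^^ (length x + length y)"
  proof -
    have "(v @ x, v) \<in> tree_edges T ^^ length x"
      by (rule tree_edges_relpow_append(2)[OF _ x(1)]) (rule closed)
    moreover have "(v, v @ y) \<in> tree_edges T ^^ length y"
      by (rule tree_edges_relpow_append(1)[OF _ y(1)]) (rule closed)
    ultimately show ?thesis unfolding relpow_add by blast
  qed
next
  fix k assume k: "(v @ x, v @ y) \<in> tree_edges T ^^ k"
  obtain i x' j y' where x': "x = i # x'" and y': "y = j # y'"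
    using x(2) y(2) by (meson neq_Nil_conv)
  show "length x + length y \<le> k"
    using tree_edges_potential[OF k, of v j] neq unfolding x' y' by simp
qed

section \<open>Cylinder events\<close>

lemma prob_PiM_pmf_cylinder:
  fixes p :: "'a pmf" and A :: "'i \<Rightarrow> 'a set"
  assumes "finite J"
  shows "measure (\<Pi>\<^sub>M i\<in>UNIV. measure_pmf p) {\<omega>. \<forall>i\<in>J. \<omega> i \<in> A i} = (\<Prod>i\<in>J. measure_pmf.prob p (A i))"
proof -
  have "product_prob_space (\<lambda>_. measure_pmf p)"
    by unfold_locales
  from product_prob_space.measure_PiM_emb[OF this, of J UNIV A]
  have "measure (\<Pi>\<^sub>M i\<in>UNIV. measure_pmf p) (prod_emb UNIV (\<lambda>_. measure_pmf p) J (Pi\<^sub>E J A)) = (\<Prod>i\<in>J. measure_pmf.prob p (A i))"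
    using assms by simp
  moreover have "prod_emb UNIV (\<lambda>_ :: 'i. measure_pmf p) J (Pi\<^sub>E J A) = {\<omega>. \<forall>i\<in>J. \<omega> i \<in> A i}"
    by (auto simp: prod_emb_def PiE_iff)
  ultimately show ?thesis by simp
qed

lemma sets_PiM_pmf_cylinder:
  fixes p :: "'a pmf" and A :: "'i \<Rightarrow> 'a set"
  assumes "finite J"
  shows "{\<omega>. \<forall>i\<in>J. \<omega> i \<in> A i} \<in> sets (\<Pi>\<^sub>M i\<in>UNIV. measure_pmf p)"
proof -
  have "prod_emb UNIV (\<lambda>_ :: 'i. measure_pmf p) J (Pi\<^sub>E J A) \<in> sets (\<Pi>\<^sub>M i\<in>UNIV. measure_pmf p)"
    using assms by (intro sets_PiM_I) auto
  moreover have "prod_emb UNIV (\<lambda>_ :: 'i. measure_pmf p) J (Pi\<^sub>E J A) = {\<omega>. \<forall>i\<in>J. \<omega> i \<in> A i}"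
    by (auto simp: prod_emb_def PiE_iff)
  ultimately show ?thesis by simp
qed

text \<open>
  The error term is a union bound: two given sampled vertices share a branch with probability at
  most \<open>\<delta>\<close>.
\<close>

lemma prob_distinct_branches:
  fixes T :: "utree" and a :: "nat \<Rightarrow> nat"
  assumes T: "finite T" "T \<noteq> {}"
    and G: "\<And>l. l \<in> a ` {..<m} \<Longrightarrow> G l \<subseteq> T"
    and branch: "\<And>l i. l \<in> a ` {..<m} \<Longrightarrow> real (card {x \<in> G l. x ! k = i}) \<le> \<delta> * real (card T)"
  defines "Q \<equiv> \<Pi>\<^sub>M i\<in>(UNIV :: nat set). measure_pmf (pmf_of_set T)"
    and "C \<equiv> {\<xi>. (\<forall>i<m. \<xi> i \<in> G (a i)) \<and> (\<forall>i<m. \<forall>j<m. i \<noteq> j \<longrightarrow> \<xi> i ! k \<noteq> \<xi> j ! k)}"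
  shows "C \<in> sets Q" and "(\<Prod>i<m. real (card (G (a i))) / real (card T)) - real m ^ 2 * \<delta> \<le> measure Q C"
proof -
  interpret Q: prob_space Q unfolding Q_def by (rule prob_space_PiM_pmf)
  define Box where "Box = {\<xi>. \<forall>i\<in>{..<m}. \<xi> i \<in> G (a i)}"
  define I where "I = {(i, j). i < m \<and> j < m \<and> i \<noteq> j}"
  define same where "same x l = {y \<in> G l. y ! k = x ! k}" for x l
  \<comment> \<open>Fixing the value \<open>x\<close> of the first vertex turns the coincidence of
    two branches into a union of cylinders, each of probability at most
    \<open>\<delta> / card T\<close>.\<close>
  define Pair where "Pair = (\<lambda>(i, j) x. {\<xi>. \<forall>h\<in>{i, j}. \<xi> h \<in> (if h = i then {x} else same x (a j))})"
  have I: "I \<subseteq> {..<m} \<times> {..<m}" by (auto simp: I_def)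
  then have finI: "finite I" by (rule finite_subset) simp
  have fin: "finite (G (a i))" if "i < m" for i using G[of "a i"] that T finite_subset by blast
  have Box: "Box \<in> sets Q" unfolding Box_def Q_def by (rule sets_PiM_pmf_cylinder) simp
  have Pair: "Pair ij x \<in> sets Q" for ij x
    unfolding Pair_def Q_def by (cases ij) (simp only: prod.case, rule sets_PiM_pmf_cylinder, simp)
  define U where "U = (\<Union>(i, j)\<in>I. \<Union>x\<in>G (a i). Pair (i, j) x)"
  have inner: "(\<Union>x\<in>G (a i). Pair (i, j) x) \<in> sets Q" if "(i, j) \<in> I" for i j
    using fin[of i] that Pair by (intro sets.finite_UN) (auto simp: I_def)
  have U: "U \<in> sets Q" unfolding U_def
    by (rule sets.finite_UN[OF finI]) (use inner in auto)
  have C: "C = Box - U"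
  proof -
    have "\<xi> \<in> U \<longleftrightarrow> (\<exists>i<m. \<exists>j<m. i \<noteq> j \<and> \<xi> i ! k = \<xi> j ! k)" if "\<xi> \<in> Box" for \<xi>
    proof
      assume "\<xi> \<in> U"
      then obtain i j x where "(i, j) \<in> I" "x \<in> G (a i)" "\<xi> \<in> Pair (i, j) x"
        unfolding U_def by blast
      then show "\<exists>i<m. \<exists>j<m. i \<noteq> j \<and> \<xi> i ! k = \<xi> j ! k"
        by (intro exI[of _ i] exI[of _ j]) (auto simp: I_def Pair_def same_def)
    next
      assume "\<exists>i<m. \<exists>j<m. i \<noteq> j \<and> \<xi> i ! k = \<xi> j ! k"
      then obtain i j where ij: "i < m" "j < m" "i \<noteq> j" "\<xi> i ! k = \<xi> j ! k" by blast
      then have "\<xi> i \<in> G (a i)" "\<xi> \<in> Pair (i, j) (\<xi> i)" "(i, j) \<in> I"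
        using that by (auto simp: Box_def Pair_def same_def I_def)
      then show "\<xi> \<in> U" unfolding U_def by blast
    qed
    then show ?thesis unfolding C_def Box_def by blast
  qed
  show "C \<in> sets Q" unfolding C using Box U by blast
  have n: "0 < real (card T)" using T by (simp add: card_gt_0_iff)
  have pmf: "measure_pmf.prob (pmf_of_set T) A = real (card A) / real (card T)" if "A \<subseteq> T" for A
    using T that by (simp add: measure_pmf_of_set Int_absorb1)
  have "measure Q (\<Union>x\<in>G (a i). Pair (i, j) x) \<le> \<delta>" if ij: "(i, j) \<in> I" for i j
  proof -
    have ij': "i < m" "j < m" "i \<noteq> j" using ij by (auto simp: I_def)
    have \<delta>: "0 \<le> \<delta>"
    proof -
      have "0 \<le> \<delta> * real (card T)" using branch[of "a i" 0] ij' by (smt (verit) imageI lessThan_iff of_nat_0_le_iff)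
      then show ?thesis using n by (simp add: zero_le_mult_iff)
    qed
    have "measure Q (Pair (i, j) x) \<le> \<delta> / real (card T)" if x: "x \<in> G (a i)" for x
    proof -
      have "measure Q (Pair (i, j) x) = (\<Prod>h\<in>{i, j}. measure_pmf.prob (pmf_of_set T) (if h = i then {x} else same x (a j)))"
        unfolding Q_def Pair_def prod.case by (rule prob_PiM_pmf_cylinder) simp
      also have "\<dots> = measure_pmf.prob (pmf_of_set T) {x} * measure_pmf.prob (pmf_of_set T) (same x (a j))"
        using ij' by simp
      also have "\<dots> = 1 / real (card T) * (real (card (same x (a j))) / real (card T))"
      proof -
        have "{x} \<subseteq> T" using x G[of "a i"] ij' by blast
        moreover have "same x (a j) \<subseteq> T" using G[of "a j"] ij' unfolding same_def by blast
        ultimately show ?thesis by (simp only: pmf) simp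
      qed
      also have "\<dots> \<le> 1 / real (card T) * \<delta>"
      proof (rule mult_left_mono)
        have "real (card (same x (a j))) \<le> \<delta> * real (card T)"
          unfolding same_def by (rule branch) (use ij' in blast)
        then show "real (card (same x (a j))) / real (card T) \<le> \<delta>"
          using n by (simp add: field_simps)
      qed simp
      finally show ?thesis by simp
    qed
    then have "(\<Sum>x\<in>G (a i). measure Q (Pair (i, j) x)) \<le> real (card (G (a i))) * (\<delta> / real (card T))"
      by (rule sum_bounded_above)
    moreover have "measure Q (\<Union>x\<in>G (a i). Pair (i, j) x) \<le> (\<Sum>x\<in>G (a i). measure Q (Pair (i, j) x))"
      by (rule Q.finite_measure_subadditive_finite) (use fin ij' Pair in auto)
    moreover have "real (card (G (a i))) * (\<delta> / real (card T)) \<le> real (card T) * (\<delta> / real (card T))"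
    proof (rule mult_right_mono)
      show "real (card (G (a i))) \<le> real (card T)"
        using card_mono[OF T(1) G[of "a i"]] ij' by simp
    qed (use \<delta> in simp)
    moreover have "real (card T) * (\<delta> / real (card T)) = \<delta>" using n by simp
    ultimately show ?thesis by linarith
  qed
  then have "(\<Sum>ij\<in>I. measure Q (case ij of (i, j) \<Rightarrow> \<Union>x\<in>G (a i). Pair (i, j) x)) \<le> (\<Sum>ij\<in>I. \<delta>)"
    by (intro sum_mono) auto
  moreover have "measure Q U \<le> (\<Sum>ij\<in>I. measure Q (case ij of (i, j) \<Rightarrow> \<Union>x\<in>G (a i). Pair (i, j) x))"
    unfolding U_def by (rule Q.finite_measure_subadditive_finite[OF finI]) (use inner in auto)
  moreover have "(\<Sum>ij\<in>I. \<delta>) \<le> real m ^ 2 * \<delta>"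
  proof (cases "I = {}")
    case True
    show ?thesis
    proof (cases "m = 0")
      case False
      then have "0 \<le> \<delta> * real (card T)" using branch[of "a 0" 0] by (smt (verit) imageI lessThan_iff of_nat_0_le_iff neq0_conv)
      then have "0 \<le> \<delta>" using n by (simp add: zero_le_mult_iff)
      then show ?thesis using True by simp
    qed (use True in simp)
  next
    case False
    then obtain i where "i < m" by (auto simp: I_def)
    then have "0 \<le> \<delta> * real (card T)" using branch[of "a i" 0] by (smt (verit) imageI lessThan_iff of_nat_0_le_iff)
    then have "0 \<le> \<delta>" using n by (simp add: zero_le_mult_iff)
    moreover have "card I \<le> m * m" using card_mono[OF _ I] by (simp add: card_cartesian_product)
    then have "real (card I) \<le> real m ^ 2" by (metis of_nat_le_iff of_nat_power power2_eq_square)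
    ultimately show ?thesis by (simp add: mult_right_mono)
  qed
  moreover have "measure Q Box = (\<Prod>i<m. real (card (G (a i))) / real (card T))"
  proof -
    have "measure Q Box = (\<Prod>i\<in>{..<m}. measure_pmf.prob (pmf_of_set T) (G (a i)))"
      unfolding Q_def Box_def by (rule prob_PiM_pmf_cylinder) simp
    also have "\<dots> = (\<Prod>i<m. real (card (G (a i))) / real (card T))"
      by (intro prod.cong refl pmf G) auto
    finally show ?thesis .
  qed
  moreover have "measure Q Box \<le> measure Q C + measure Q U"
  proof -
    have "measure Q Box \<le> measure Q (C \<union> U)"
      by (rule Q.finite_measure_mono) (use C Box U in auto)
    also have "\<dots> \<le> measure Q C + measure Q U"
      by (rule measure_Un_le) (use C Box U in auto)
    finally show ?thesis .
  qed
  ultimately show "(\<Prod>i<m. real (card (G (a i))) / real (card T)) - real m ^ 2 * \<delta> \<le> measure Q C"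
    by linarith
qed

text \<open>\<open>c i\<close> may exceed \<open>b i\<close> by any amount, so the telescoping
  estimate is applied to the minimum of both, which is within \<delta> of \<open>b i\<close> and
  below \<open>c i\<close>.\<close>

lemma prod_lower_bound:
  fixes b c :: "nat \<Rightarrow> real"
  assumes b: "\<And>i. i < m \<Longrightarrow> 0 \<le> b i \<and> b i \<le> 1" and c: "\<And>i. i < m \<Longrightarrow> 0 \<le> c i \<and> c i \<le> 1"
    and le: "\<And>i. i < m \<Longrightarrow> b i - \<delta> \<le> c i" and "0 \<le> \<delta>"
  shows "(\<Prod>i<m. b i) - real m * \<delta> \<le> (\<Prod>i<m. c i)"
proof -
  have "norm ((\<Prod>i<m. min (b i) (c i)) - (\<Prod>i<m. b i)) \<le> (\<Sum>i<m. norm (min (b i) (c i) - b i))"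
    by (rule norm_prod_diff) (use b c in \<open>auto simp: min_def\<close>)
  also have "\<dots> \<le> (\<Sum>i<m. \<delta>)"
    by (intro sum_mono) (use le \<open>0 \<le> \<delta>\<close> in \<open>force simp: min_def\<close>)
  finally have "(\<Prod>i<m. b i) - real m * \<delta> \<le> (\<Prod>i<m. min (b i) (c i))" by simp
  also have "\<dots> \<le> (\<Prod>i<m. c i)"
    by (intro prod_mono) (use b c in auto)
  finally show ?thesis .
qed

section \<open>Functions of the upper left block\<close>

text \<open>The largest minorant of \<open>f\<close> that sees only the block of size
  \<open>m\<close>. It need not be continuous, but it is integrated only along star matrices with
  integer heights, where its measurability is a discrete matter.\<close>

definition block_inf :: "((nat \<Rightarrow> nat \<Rightarrow> real) \<Rightarrow> real) \<Rightarrow> nat \<Rightarrow> (nat \<Rightarrow> nat \<Rightarrow> real) \<Rightarrow> real" where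
  "block_inf f m x = Inf {f y | y. \<forall>i<m. \<forall>j<m. y i j = x i j}"

lemma block_inf_le:
  assumes "\<And>y. 0 \<le> f y" "\<And>i j. i < m \<Longrightarrow> j < m \<Longrightarrow> y i j = x i j"
  shows "block_inf f m x \<le> f y"
  unfolding block_inf_def
proof (rule cInf_lower)
  show "bdd_below {f y | y. \<forall>i<m. \<forall>j<m. y i j = x i j}"
    by (rule bdd_belowI[of _ 0]) (use assms(1) in auto)
qed (use assms(2) in blast)

lemma block_inf_greatest:
  assumes "\<And>y. (\<And>i j. i < m \<Longrightarrow> j < m \<Longrightarrow> y i j = x i j) \<Longrightarrow> a \<le> f y"
  shows "a \<le> block_inf f m x"
  unfolding block_inf_def by (rule cInf_greatest) (use assms in auto)

lemma block_inf_cong: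
  assumes "\<And>i j. i < m \<Longrightarrow> j < m \<Longrightarrow> x i j = x' i j"
  shows "block_inf f m x = block_inf f m x'"
  unfolding block_inf_def using assms by simp

lemma tendsto_fun_iff:
  fixes X :: "'b \<Rightarrow> 'i \<Rightarrow> 'a :: topological_space"
  shows "(X \<longlongrightarrow> l) F \<longleftrightarrow> (\<forall>i. ((\<lambda>n. X n i) \<longlongrightarrow> l i) F)"
  using limitin_componentwise[of "\<lambda>_ :: 'i. euclidean :: 'a topology" UNIV X l F]
  by (simp add: euclidean_product_topology)

text \<open>Matrices that agree with \<open>x\<close> on growing blocks converge to \<open>x\<close>
  in the product topology, so continuity of \<open>f\<close> excludes values that stay below
  \<open>f x\<close> by a fixed amount.\<close>

lemma block_inf_tendsto:
  assumes cont: "continuous_on UNIV f" and nonneg: "\<And>y. 0 \<le> f y"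
  shows "(\<lambda>m. block_inf f m x) \<longlonglongrightarrow> f x"
proof (rule tendstoI)
  fix e :: real assume e: "0 < e"
  have "\<exists>m0. \<forall>y. (\<forall>i<m0. \<forall>j<m0. y i j = x i j) \<longrightarrow> f x - e / 2 \<le> f y"
  proof (rule ccontr)
    assume "\<not> ?thesis"
    then have "\<forall>m. \<exists>y. (\<forall>i<m. \<forall>j<m. y i j = x i j) \<and> f y < f x - e / 2"
      unfolding not_le[symmetric] by blast
    from choice[OF this] obtain Y
      where Y: "\<And>m i j. i < m \<Longrightarrow> j < m \<Longrightarrow> Y m i j = x i j" "\<And>m. f (Y m) < f x - e / 2"
      by blast
    have "Y \<longlonglongrightarrow> x"
    proof (subst tendsto_fun_iff, intro allI, subst tendsto_fun_iff, intro allI)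
      fix i j
      have "eventually (\<lambda>m. Y m i j = x i j) sequentially"
        using eventually_gt_at_top[of "max i j"] by eventually_elim (rule Y(1), auto)
      then show "(\<lambda>m. Y m i j) \<longlonglongrightarrow> x i j" by (rule tendsto_eventually)
    qed
    then have "(\<lambda>m. f (Y m)) \<longlonglongrightarrow> f x"
      by (rule continuous_on_tendsto_compose[OF cont]) simp_all
    then have "f x \<le> f x - e / 2"
      by (rule LIMSEQ_le_const2) (intro exI[of _ 0] allI impI less_imp_le Y(2))
    then show False using e by simp
  qed
  then obtain m0 where m0: "\<forall>y. (\<forall>i<m0. \<forall>j<m0. y i j = x i j) \<longrightarrow> f x - e / 2 \<le> f y" ..
  show "eventually (\<lambda>m. dist (block_inf f m x) (f x) < e) sequentially"
    using eventually_ge_at_top[of m0]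
  proof eventually_elim
    case (elim m)
    have "f x - e / 2 \<le> block_inf f m x"
      by (rule block_inf_greatest, rule m0[rule_format]) (use elim in auto)
    moreover have "block_inf f m x \<le> f x" by (rule block_inf_le[OF nonneg]) simp
    ultimately show ?case using e by (simp add: dist_real_def)
  qed
qed

section \<open>Weak convergence of the sampling measures\<close>

lemma borel_measurable_matrix:
  fixes F :: "'a \<Rightarrow> nat \<Rightarrow> nat \<Rightarrow> real"
  assumes "\<And>i j. (\<lambda>\<omega>. F \<omega> i j) \<in> borel_measurable M"
  shows "F \<in> borel_measurable M"
  by (intro measurable_coordinatewise_then_product assms)

lemma (in prob_space) expectation_indicator_sum:
  assumes "finite I" "\<And>i. i \<in> I \<Longrightarrow> A i \<in> events"
  shows "integrable M (\<lambda>x. \<Sum>i\<in>I. indicator (A i) x * (c i :: real))"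
    and "expectation (\<lambda>x. \<Sum>i\<in>I. indicator (A i) x * (c i :: real)) = (\<Sum>i\<in>I. prob (A i) * c i)"
proof -
  have int: "integrable M (\<lambda>x. indicator (A i) x * c i)" if "i \<in> I" for i
    using assms(2)[OF that] by (intro integrable_mult_left integrable_real_indicator) (auto simp: emeasure_eq_measure)
  show "integrable M (\<lambda>x. \<Sum>i\<in>I. indicator (A i) x * c i)"
    by (rule Bochner_Integration.integrable_sum[OF int])
  have "expectation (\<lambda>x. \<Sum>i\<in>I. indicator (A i) x * c i) = (\<Sum>i\<in>I. expectation (\<lambda>x. indicator (A i) x * c i))"
    by (rule Bochner_Integration.integral_sum[OF int])
  also have "\<dots> = (\<Sum>i\<in>I. prob (A i) * c i)"
    using assms(2) sets.Int_space_eq2 by (intro sum.cong) auto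
  finally show "expectation (\<lambda>x. \<Sum>i\<in>I. indicator (A i) x * c i) = (\<Sum>i\<in>I. prob (A i) * c i)" .
qed

definition star_matrix :: "(nat \<Rightarrow> nat) \<Rightarrow> nat \<Rightarrow> nat \<Rightarrow> real" where
  "star_matrix \<eta> = (\<lambda>i j. if i \<noteq> j then real (\<eta> i + 1) + real (\<eta> j + 1) else 0)"

definition tree_matrix :: "utree \<Rightarrow> (nat \<Rightarrow> nat list) \<Rightarrow> nat \<Rightarrow> nat \<Rightarrow> real" where
  "tree_matrix T \<xi> = (\<lambda>i j. if i \<noteq> j then real (tree_dist T (\<xi> i) (\<xi> j)) else 0)"

lemma measurable_component_pmf:
  "(\<lambda>\<omega>. \<omega> i) \<in> measurable (\<Pi>\<^sub>M i\<in>UNIV. measure_pmf p) (count_space UNIV)"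
  by (rule measurable_compose[OF measurable_component_singleton]) auto

lemma measurable_star_matrix:
  "star_matrix \<in> borel_measurable (\<Pi>\<^sub>M i\<in>UNIV. measure_pmf p)"
proof (rule borel_measurable_matrix)
  fix i j
  have meas: "(\<lambda>\<omega>. real (\<omega> k + 1)) \<in> borel_measurable (\<Pi>\<^sub>M i\<in>UNIV. measure_pmf p)" for k
    by (rule measurable_compose[OF measurable_component_pmf]) simp
  show "(\<lambda>\<omega>. star_matrix \<omega> i j) \<in> borel_measurable (\<Pi>\<^sub>M i\<in>UNIV. measure_pmf p)"
  proof (cases "i = j")
    case False
    then have "(\<lambda>\<omega>. star_matrix \<omega> i j) = (\<lambda>\<omega>. real (\<omega> i + 1) + real (\<omega> j + 1))"
      by (simp add: star_matrix_def)
    then show ?thesis using borel_measurable_add[OF meas meas] by (simp only:)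
  qed (simp add: star_matrix_def)
qed

lemma measurable_tree_matrix:
  "tree_matrix T \<in> borel_measurable (\<Pi>\<^sub>M i\<in>UNIV. measure_pmf p)"
proof (rule borel_measurable_matrix)
  fix i j :: nat
  have "(\<lambda>\<omega>. real (tree_dist T (\<omega> i) (\<omega> j))) \<in> borel_measurable (\<Pi>\<^sub>M i\<in>(UNIV :: nat set). measure_pmf p)"
    by (rule measurable_compose_countable[where g = "\<lambda>\<omega>. \<omega> j", OF _ measurable_component_pmf])
       (rule measurable_compose[OF measurable_component_pmf], simp)
  then show "(\<lambda>\<omega>. tree_matrix T \<omega> i j) \<in> borel_measurable (\<Pi>\<^sub>M i\<in>UNIV. measure_pmf p)"
    unfolding tree_matrix_def by (cases "i = j") simp_all
qed

lemma tau_tree_eq: "tau_tree T = distr (\<Pi>\<^sub>M i\<in>UNIV. measure_pmf (pmf_of_set T)) borel (tree_matrix T)"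
  unfolding tau_tree_def tree_matrix_def ..

text \<open>Independent geometric counts, each shifted by 1, have the product of the laws
  \<open>Ge p\<close> as joint law. This moves all computations to a product of discrete spaces,
  where cylinder probabilities are available.\<close>

lemma tau_Upsilon_Ge:
  "tau_Upsilon (Ge p) = distr (\<Pi>\<^sub>M i\<in>UNIV. measure_pmf (geometric_pmf p)) borel star_matrix"
proof -
  let ?N = "\<Pi>\<^sub>M i\<in>(UNIV :: nat set). measure_pmf (geometric_pmf p)"
  let ?X = "\<lambda>i (\<eta> :: nat \<Rightarrow> nat). real (\<eta> i + 1)"
  let ?P = "\<Pi>\<^sub>M i\<in>(UNIV :: nat set). (borel :: real measure)"
  interpret N: prob_space ?N by (rule prob_space_PiM_pmf)
  have comp: "distr ?N borel (?X i) = Ge p" for i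
  proof -
    have "Ge p = distr (distr ?N (measure_pmf (geometric_pmf p)) (\<lambda>\<eta>. \<eta> i)) borel (\<lambda>k. real (k + 1))"
      unfolding Ge_def by (subst distr_PiM_component) (auto simp: measure_pmf.prob_space_axioms)
    also have "\<dots> = distr ?N borel (?X i)"
      using distr_distr[OF _ measurable_component_singleton[of i UNIV "\<lambda>_. measure_pmf (geometric_pmf p)"],
          of "\<lambda>k. real (k + 1)" borel]
      by (simp only: comp_def UNIV_I) simp
    finally show ?thesis ..
  qed
  have X: "?X i \<in> borel_measurable ?N" for i
    by (rule measurable_compose[OF measurable_component_pmf]) simp
  have "N.indep_vars (\<lambda>_. borel) ?X UNIV"
    by (rule N.indep_vars_compose2[OF indep_vars_PiM_pmf]) simp
  then have "distr ?N ?P (\<lambda>\<eta> i. ?X i \<eta>) = (\<Pi>\<^sub>M i\<in>UNIV. Ge p)"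
    using N.indep_vars_iff_distr_eq_PiM'[where I = UNIV and M' = "\<lambda>_. borel" and X = ?X, OF UNIV_not_empty X]
    by (simp only: comp restrict_UNIV)
  then have "tau_Upsilon (Ge p) = distr (distr ?N ?P (\<lambda>\<eta> i. ?X i \<eta>)) borel (\<lambda>\<eta> i j. if i \<noteq> j then \<eta> i + \<eta> j else 0)"
    unfolding tau_Upsilon_def by simp
  also have "\<dots> = distr ?N borel star_matrix"
  proof (subst distr_distr)
    show "(\<lambda>\<eta> i j. if i \<noteq> j then \<eta> i + \<eta> j else (0 :: real)) \<in> measurable ?P borel"
    proof (rule borel_measurable_matrix)
      show "(\<lambda>\<eta>. if i \<noteq> j then \<eta> i + \<eta> j else (0 :: real)) \<in> borel_measurable ?P" for i j
        by (cases "i = j") auto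
    qed
    show "(\<lambda>\<eta> i. ?X i \<eta>) \<in> measurable ?N ?P"
      by (rule measurable_PiM_single'[OF X]) (simp add: PiE_UNIV_domain)
  qed (simp only: comp_def star_matrix_def[abs_def])
  finally show ?thesis .
qed

lemma prob_space_tau_tree: "prob_space (tau_tree T)"
  unfolding tau_tree_eq by (rule prob_space.prob_space_distr[OF prob_space_PiM_pmf measurable_tree_matrix])

lemma prob_space_tau_Upsilon_Ge: "prob_space (tau_Upsilon (Ge p))"
  unfolding tau_Upsilon_Ge by (rule prob_space.prob_space_distr[OF prob_space_PiM_pmf measurable_star_matrix])

lemma prob_geometric_tail:
  assumes "0 < \<kappa>" "\<kappa> < 1"
  shows "measure_pmf.prob (geometric_pmf (1 - \<kappa>)) {L..} = \<kappa> ^ L"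
proof -
  have "measure_pmf.prob (geometric_pmf (1 - \<kappa>)) {..<L} = (\<Sum>k<L. \<kappa> ^ k * (1 - \<kappa>))"
    using assms by (subst measure_measure_pmf_finite) auto
  also have "\<dots> = 1 - \<kappa> ^ L"
    unfolding sum_distrib_right[symmetric] using one_diff_power_eq[of \<kappa> L] by (simp add: mult.commute)
  finally have "measure_pmf.prob (geometric_pmf (1 - \<kappa>)) (UNIV - {..<L}) = \<kappa> ^ L"
    using measure_pmf.prob_compl[of "{..<L}" "geometric_pmf (1 - \<kappa>)"] by simp
  moreover have "UNIV - {..<L} = {L..}" by auto
  ultimately show ?thesis by simp
qed

text \<open>A one-sided bound suffices, because it will be applied to both \<open>B + f\<close> and \<open>B - f\<close>.\<close>

lemma tau_tree_lower_bound:
  fixes f :: "(nat \<Rightarrow> nat \<Rightarrow> real) \<Rightarrow> real"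
  assumes \<kappa>: "0 < \<kappa>" "\<kappa> < 1" and cont: "continuous_on UNIV f"
    and nonneg: "\<And>x. 0 \<le> f x" and bound: "\<And>x. f x \<le> B" and \<epsilon>: "0 < \<epsilon>"
  shows "\<exists>L. \<exists>\<delta>>0. \<forall>T v. T \<in> range family_tree \<longrightarrow> finite T \<longrightarrow>
      spread_below T v (\<lambda>l. (1 - \<kappa>) * \<kappa> ^ (l - 1)) \<delta> L \<longrightarrow>
      (\<integral>x. f x \<partial>tau_Upsilon (Ge (1 - \<kappa>))) - \<epsilon> \<le> (\<integral>x. f x \<partial>tau_tree T)"
proof -
  let ?N = "\<Pi>\<^sub>M i\<in>(UNIV :: nat set). measure_pmf (geometric_pmf (1 - \<kappa>))"
  interpret N: prob_space ?N by (rule prob_space_PiM_pmf)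
  have f: "f \<in> borel_measurable borel" by (rule borel_measurable_continuous_onI[OF cont])
  have B: "0 \<le> B" using nonneg[of "\<lambda>_ _. 0"] bound[of "\<lambda>_ _. 0"] by linarith
  define h where "h m \<eta> = block_inf f m (star_matrix \<eta>)" for m \<eta>
  \<comment> \<open>\<open>h m\<close> as a function of the list of the first \<open>m\<close>
    counts, of which there are countably many.\<close>
  define H where "H m l = block_inf f m (star_matrix (\<lambda>i. l ! i))" for m l
  have h_H: "h m \<eta> = H m (map \<eta> [0..<m])" for m \<eta>
    unfolding h_def H_def by (rule block_inf_cong) (simp add: star_matrix_def)
  have h0: "0 \<le> h m \<eta>" for m \<eta> unfolding h_def by (rule block_inf_greatest) (rule nonneg)
  have hf: "h m \<eta> \<le> f (star_matrix \<eta>)" for m \<eta> unfolding h_def by (rule block_inf_le[OF nonneg]) simp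
  have hB: "h m \<eta> \<le> B" for m \<eta> using hf bound by (rule order_trans)
  have H0: "0 \<le> H m l" for m l unfolding H_def by (rule block_inf_greatest) (rule nonneg)
  have HB: "H m l \<le> B" for m l unfolding H_def by (rule order_trans[OF block_inf_le[OF nonneg] bound]) simp
  have meas_h: "h m \<in> borel_measurable ?N" for m
  proof -
    have map_eq: "map \<eta> [0..<m] = l \<longleftrightarrow> length l = m \<and> (\<forall>i<m. \<eta> i = l ! i)" for \<eta> and l :: "nat list"
      by (auto simp: list_eq_iff_nth_eq)
    have vimage: "(\<lambda>\<eta>. map \<eta> [0..<m]) -` {l} \<inter> space ?N \<in> sets ?N" for l :: "nat list"
    proof (cases "length l = m")
      case True
      then have "(\<lambda>\<eta>. map \<eta> [0..<m]) -` {l} \<inter> space ?N = {\<eta>. \<forall>i\<in>{..<m}. \<eta> i \<in> {l ! i}}"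
        unfolding vimage_def singleton_iff map_eq by (simp add: Ball_def)
      then show ?thesis by (simp only: sets_PiM_pmf_cylinder finite_lessThan)
    next
      case False
      then have "(\<lambda>\<eta>. map \<eta> [0..<m]) -` {l} \<inter> space ?N = {}"
        unfolding vimage_def singleton_iff map_eq by simp
      then show ?thesis by (simp only: sets.empty_sets)
    qed
    have "(\<lambda>\<eta>. map \<eta> [0..<m]) \<in> measurable ?N (count_space UNIV)"
      unfolding measurable_count_space_eq2_countable by (intro conjI ballI vimage) simp
    then have "(\<lambda>\<eta>. H m (map \<eta> [0..<m])) \<in> borel_measurable ?N"
      by (rule measurable_compose) simp
    moreover have "h m = (\<lambda>\<eta>. H m (map \<eta> [0..<m]))" by (rule ext) (rule h_H)
    ultimately show ?thesis by (simp only:)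
  qed
  have "(\<lambda>m. N.expectation (h m)) \<longlonglongrightarrow> N.expectation (\<lambda>\<eta>. f (star_matrix \<eta>))"
  proof (rule integral_dominated_convergence[where w = "\<lambda>_. B"])
    show "(\<lambda>\<eta>. f (star_matrix \<eta>)) \<in> borel_measurable ?N"
      by (rule measurable_compose[OF measurable_star_matrix f])
    show "AE \<eta> in ?N. (\<lambda>m. h m \<eta>) \<longlonglongrightarrow> f (star_matrix \<eta>)"
      unfolding h_def by (intro AE_I2 block_inf_tendsto cont nonneg)
    show "AE \<eta> in ?N. norm (h m \<eta>) \<le> B" for m
      using h0 hB by (intro AE_I2) simp
  qed (use meas_h in simp_all)
  then have "eventually (\<lambda>m. N.expectation (\<lambda>\<eta>. f (star_matrix \<eta>)) - \<epsilon> / 3 < N.expectation (h m)) sequentially"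
    by (rule order_tendstoD(1)) (use \<epsilon> in simp)
  from eventually_happens'[OF sequentially_bot this]
  obtain m where m: "N.expectation (\<lambda>\<eta>. f (star_matrix \<eta>)) - \<epsilon> / 3 < N.expectation (h m)" ..
  \<comment> \<open>One of the first \<open>m\<close> counts is at least \<open>L\<close>, that is,
    one depth exceeds \<open>L\<close>, with probability at most \<open>m * \<kappa> ^ L\<close>; on
    that event \<open>h m\<close> is bounded by \<open>B\<close> only.\<close>
  have "(\<lambda>L. B * (real m * \<kappa> ^ L)) \<longlonglongrightarrow> B * (real m * 0)"
    using \<kappa> by (intro tendsto_mult tendsto_const LIMSEQ_power_zero) simp
  then have "eventually (\<lambda>L. B * (real m * \<kappa> ^ L) < \<epsilon> / 3) sequentially"
    by (rule order_tendstoD(2)) (use \<epsilon> in simp)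
  from eventually_happens'[OF sequentially_bot this]
  obtain L where L: "B * (real m * \<kappa> ^ L) < \<epsilon> / 3" ..
  \<comment> \<open>Counts below \<open>L\<close> correspond to depths in \<open>{1..L}\<close>, the
    levels that \<open>spread_below\<close> controls.\<close>
  define Ls where "Ls = {l :: nat list. set l \<subseteq> {..<L} \<and> length l = m}"
  have finLs: "finite Ls" unfolding Ls_def by (rule finite_lists_length_eq) simp
  \<comment> \<open>For each list in \<open>Ls\<close>, the probability in the tree may fall short
    by \<open>real m * \<delta>\<close>, from the proportions of the levels, and by
    \<open>real m ^ 2 * \<delta>\<close>, from coinciding branches; the values of \<open>H m\<close>
    are at most \<open>B\<close>.\<close>
  define W where "W = real (card Ls) * ((real m + real m ^ 2) * B)"
  have W: "0 \<le> W" using B by (simp add: W_def)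
  define \<delta> where "\<delta> = \<epsilon> / (3 * (W + 1))"
  have \<delta>: "0 < \<delta>" using W \<epsilon> by (simp add: \<delta>_def)
  have W\<delta>: "W * \<delta> \<le> \<epsilon> / 3"
  proof -
    have "W * \<delta> = \<epsilon> / 3 * (W / (W + 1))" by (simp add: \<delta>_def)
    also have "\<dots> \<le> \<epsilon> / 3 * 1" using W \<epsilon> by (intro mult_left_mono) auto
    finally show ?thesis by simp
  qed
  define g where "g l = (1 - \<kappa>) * \<kappa> ^ (l - 1)" for l :: nat
  have g01: "0 \<le> g l \<and> g l \<le> 1" for l
    using \<kappa> by (auto simp: g_def intro!: mult_le_one power_le_one)
  define c where "c l = {\<eta> :: nat \<Rightarrow> nat. \<forall>i\<in>{..<m}. \<eta> i \<in> {l ! i}}" for l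
  have sets_c: "c l \<in> sets ?N" for l
    unfolding c_def by (rule sets_PiM_pmf_cylinder) simp
  have prob_c: "N.prob (c l) = (\<Prod>i<m. g (l ! i + 1))" for l
  proof -
    have "N.prob (c l) = (\<Prod>i<m. measure_pmf.prob (geometric_pmf (1 - \<kappa>)) {l ! i})"
      unfolding c_def by (rule prob_PiM_pmf_cylinder) simp
    also have "\<dots> = (\<Prod>i<m. g (l ! i + 1))"
      using \<kappa> by (intro prod.cong) (simp_all add: measure_pmf_single g_def)
    finally show ?thesis .
  qed
  define R where "R i = {\<eta> :: nat \<Rightarrow> nat. \<forall>j\<in>{i}. \<eta> j \<in> {L..}}" for i
  have sets_R: "R i \<in> sets ?N" for i
    unfolding R_def by (rule sets_PiM_pmf_cylinder) simp
  have prob_R: "N.prob (R i) = \<kappa> ^ L" for i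
  proof -
    have "N.prob (R i) = (\<Prod>j\<in>{i}. measure_pmf.prob (geometric_pmf (1 - \<kappa>)) {L..})"
      unfolding R_def by (rule prob_PiM_pmf_cylinder) simp
    then show ?thesis using prob_geometric_tail[OF \<kappa>] by simp
  qed
  let ?s = "\<lambda>\<eta>. \<Sum>l\<in>Ls. indicator (c l) \<eta> * H m l"
  let ?t = "\<lambda>\<eta>. \<Sum>i\<in>{..<m}. indicator (R i) \<eta> * B"
  have pointwise: "h m \<eta> \<le> ?s \<eta> + ?t \<eta>" for \<eta>
  proof (cases "\<exists>i<m. L \<le> \<eta> i")
    case True
    then obtain i where i: "i < m" "L \<le> \<eta> i" by blast
    have "indicator (R i) \<eta> * B \<le> ?t \<eta>"
      by (rule member_le_sum[of i "{..<m}" "\<lambda>i. indicator (R i) \<eta> * B"]) (use i B in auto)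
    moreover have "indicator (R i) \<eta> * B = B" using i by (simp add: R_def)
    moreover have "0 \<le> ?s \<eta>" by (intro sum_nonneg mult_nonneg_nonneg H0) simp
    ultimately show ?thesis using hB[of m \<eta>] by linarith
  next
    case False
    let ?l = "map \<eta> [0..<m]"
    have l: "?l \<in> Ls" using False by (auto simp: Ls_def not_le)
    have "indicator (c ?l) \<eta> * H m ?l \<le> ?s \<eta>"
      by (rule member_le_sum[of ?l Ls "\<lambda>l. indicator (c l) \<eta> * H m l"]) (use l finLs H0 in auto)
    moreover have "indicator (c ?l) \<eta> * H m ?l = h m \<eta>" by (simp add: c_def h_H)
    moreover have "0 \<le> ?t \<eta>" by (intro sum_nonneg mult_nonneg_nonneg B) simp
    ultimately show ?thesis by linarith
  qed
  have "N.expectation (h m) \<le> N.expectation (\<lambda>\<eta>. ?s \<eta> + ?t \<eta>)"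
  proof (rule integral_mono)
    show "integrable ?N (h m)"
      by (rule N.integrable_const_bound[of _ B]) (use meas_h h0 hB in simp_all)
    show "integrable ?N (\<lambda>\<eta>. ?s \<eta> + ?t \<eta>)"
      by (intro Bochner_Integration.integrable_add N.expectation_indicator_sum(1) finLs sets_c sets_R) simp
  qed (rule pointwise)
  also have "\<dots> = N.expectation ?s + N.expectation ?t"
    by (intro Bochner_Integration.integral_add N.expectation_indicator_sum(1) finLs sets_c sets_R) simp
  also have "N.expectation ?s = (\<Sum>l\<in>Ls. N.prob (c l) * H m l)"
    by (rule N.expectation_indicator_sum(2)[OF finLs sets_c])
  also have "N.expectation ?t = (\<Sum>i\<in>{..<m}. N.prob (R i) * B)"
    by (rule N.expectation_indicator_sum(2)[OF _ sets_R]) simp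
  also have "\<dots> = B * (real m * \<kappa> ^ L)"
    by (simp add: prob_R)
  finally have upper: "N.expectation (h m) \<le> (\<Sum>l\<in>Ls. N.prob (c l) * H m l) + B * (real m * \<kappa> ^ L)" .
  have Ups: "(\<integral>x. f x \<partial>tau_Upsilon (Ge (1 - \<kappa>))) = N.expectation (\<lambda>\<eta>. f (star_matrix \<eta>))"
    unfolding tau_Upsilon_Ge by (rule integral_distr[OF measurable_star_matrix f])
  have main: "(\<integral>x. f x \<partial>tau_Upsilon (Ge (1 - \<kappa>))) - \<epsilon> \<le> (\<integral>x. f x \<partial>tau_tree T)"
    if T: "T \<in> range family_tree" "finite T" and spread: "spread_below T v g \<delta> L" for T v
  proof -
    let ?Q = "\<Pi>\<^sub>M i\<in>(UNIV :: nat set). measure_pmf (pmf_of_set T)"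
    interpret Q: prob_space ?Q by (rule prob_space_PiM_pmf)
    obtain t where t: "T = family_tree t" using T(1) by blast
    have closed: "u \<in> T" if "u @ w \<in> T" for u w
      using that unfolding t family_tree_append_iff by blast
    have "T \<noteq> {}" unfolding t using family_tree.root by blast
    have n: "0 < real (card T)" using T(2) \<open>T \<noteq> {}\<close> by (simp add: card_gt_0_iff)
    obtain G where G: "\<forall>l\<in>{1..L}. G l \<subseteq> T \<inter> {v @ u | u. length u = l} \<and>
         (g l - \<delta>) * real (card T) \<le> real (card (G l)) \<and>
         (\<forall>i. real (card {x \<in> G l. x ! length v = i}) \<le> \<delta> * real (card T))"
      using spread unfolding spread_below_def by blast
    \<comment> \<open>The depths below \<open>v\<close> are prescribed and the branches are
      distinct: under these two conditions the block of distances is that of a star matrix.\<close>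
    define C where "C l = {\<xi>. (\<forall>i<m. \<xi> i \<in> G (l ! i + 1)) \<and> (\<forall>i<m. \<forall>j<m. i \<noteq> j \<longrightarrow> \<xi> i ! length v \<noteq> \<xi> j ! length v)}"
      for l :: "nat list"
    have level: "l ! i + 1 \<in> {1..L}" if "l \<in> Ls" "i < m" for l i
    proof -
      have "l ! i \<in> {..<L}" using that by (auto simp: Ls_def subset_iff)
      then show ?thesis by simp
    qed
    have sets_C: "C l \<in> sets ?Q" and prob_C: "N.prob (c l) - (real m + real m ^ 2) * \<delta> \<le> Q.prob (C l)" if l: "l \<in> Ls" for l
    proof -
      have G1: "G k \<subseteq> T" and G2: "real (card {x \<in> G k. x ! length v = i}) \<le> \<delta> * real (card T)"
        and G3: "g k - \<delta> \<le> real (card (G k)) / real (card T)" and G4: "card (G k) \<le> card T"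
        if "k \<in> (\<lambda>i. l ! i + 1) ` {..<m}" for k i
      proof -
        have k: "k \<in> {1..L}" using that level[OF l] by auto
        show "G k \<subseteq> T" using G k by blast
        then show "card (G k) \<le> card T" by (rule card_mono[OF T(2)])
        show "real (card {x \<in> G k. x ! length v = i}) \<le> \<delta> * real (card T)" using G k by blast
        have "(g k - \<delta>) * real (card T) \<le> real (card (G k))" using G k by blast
        then show "g k - \<delta> \<le> real (card (G k)) / real (card T)" using n by (simp add: field_simps)
      qed
      show "C l \<in> sets ?Q"
        unfolding C_def by (rule prob_distinct_branches(1)[OF T(2) \<open>T \<noteq> {}\<close> G1 G2])
      have "(\<Prod>i<m. g (l ! i + 1)) - real m * \<delta> \<le> (\<Prod>i<m. real (card (G (l ! i + 1))) / real (card T))"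
      proof (rule prod_lower_bound)
        fix i assume i: "i < m"
        show "0 \<le> g (l ! i + 1) \<and> g (l ! i + 1) \<le> 1" by (rule g01)
        show "0 \<le> real (card (G (l ! i + 1))) / real (card T) \<and> real (card (G (l ! i + 1))) / real (card T) \<le> 1"
          using n G4[of "l ! i + 1"] i by simp
        show "g (l ! i + 1) - \<delta> \<le> real (card (G (l ! i + 1))) / real (card T)"
          by (rule G3) (use i in simp)
      qed (use \<delta> in simp)
      moreover have "(\<Prod>i<m. real (card (G (l ! i + 1))) / real (card T)) - real m ^ 2 * \<delta> \<le> Q.prob (C l)"
        unfolding C_def by (rule prob_distinct_branches(2)[OF T(2) \<open>T \<noteq> {}\<close> G1 G2])
      ultimately show "N.prob (c l) - (real m + real m ^ 2) * \<delta> \<le> Q.prob (C l)"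
        unfolding prob_c by (simp add: algebra_simps)
    qed
    have coord: "\<exists>u. \<xi> i = v @ u \<and> length u = l ! i + 1 \<and> v @ u \<in> T" if "l \<in> Ls" "\<xi> \<in> C l" "i < m" for \<xi> l i
    proof -
      have "\<xi> i \<in> G (l ! i + 1)" using that by (simp add: C_def)
      then have "\<xi> i \<in> T \<inter> {v @ u | u. length u = l ! i + 1}"
        using bspec[OF G level[OF that(1,3)]] by (metis (no_types, lifting) subsetD)
      then show ?thesis by auto
    qed
    have H_le: "H m l \<le> f (tree_matrix T \<xi>)" if l: "l \<in> Ls" and \<xi>: "\<xi> \<in> C l" for l \<xi>
      unfolding H_def
    proof (rule block_inf_le[OF nonneg])
      fix i j assume ij: "i < m" "j < m"
      obtain x where x: "\<xi> i = v @ x" "length x = l ! i + 1" "v @ x \<in> T" using coord[OF l \<xi> ij(1)] by blast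
      obtain y where y: "\<xi> j = v @ y" "length y = l ! j + 1" "v @ y \<in> T" using coord[OF l \<xi> ij(2)] by blast
      show "tree_matrix T \<xi> i j = star_matrix (\<lambda>i. l ! i) i j"
      proof (cases "i = j")
        case False
        then have "\<xi> i ! length v \<noteq> \<xi> j ! length v" using \<xi> ij by (simp add: C_def)
        then have "x ! 0 \<noteq> y ! 0" by (simp add: x(1) y(1) nth_append)
        moreover have "x \<noteq> []" "y \<noteq> []" using x(2) y(2) by auto
        ultimately have "tree_dist T (v @ x) (v @ y) = length x + length y"
          by (intro tree_dist_branches[OF _ x(3) _ y(3)]) (rule closed)
        then show ?thesis using False by (simp add: tree_matrix_def star_matrix_def x y)
      qed (simp add: tree_matrix_def star_matrix_def)
    qed
    \<comment> \<open>A sampled vertex has only one depth below \<open>v\<close>, so the events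
      \<open>C l\<close> are disjoint and at most one term of \<open>?u\<close> is nonzero.\<close>
    have disj: "l = l'" if l: "l \<in> Ls" "l' \<in> Ls" "\<xi> \<in> C l" "\<xi> \<in> C l'" for l l' \<xi>
    proof (rule nth_equalityI)
      show "length l = length l'" using that by (simp add: Ls_def)
      fix i assume "i < length l"
      then have i: "i < m" using that by (simp add: Ls_def)
      obtain x where x: "\<xi> i = v @ x" "length x = l ! i + 1" using coord[OF l(1,3) i] by blast
      obtain y where y: "\<xi> i = v @ y" "length y = l' ! i + 1" using coord[OF l(2,4) i] by blast
      show "l ! i = l' ! i" using x y by simp
    qed
    let ?u = "\<lambda>\<xi>. \<Sum>l\<in>Ls. indicator (C l) \<xi> * H m l"
    have pointwise: "?u \<xi> \<le> f (tree_matrix T \<xi>)" for \<xi>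
    proof (cases "\<exists>l\<in>Ls. \<xi> \<in> C l")
      case True
      then obtain l0 where l0: "l0 \<in> Ls" "\<xi> \<in> C l0" by blast
      have "?u \<xi> = (\<Sum>l\<in>Ls. if l = l0 then H m l0 else 0)"
      proof (rule sum.cong[OF refl])
        fix l assume l: "l \<in> Ls"
        show "indicator (C l) \<xi> * H m l = (if l = l0 then H m l0 else 0)"
          using disj[OF l l0(1) _ l0(2)] l0 by (cases "\<xi> \<in> C l") auto
      qed
      also have "\<dots> = H m l0" using finLs l0 by simp
      also have "\<dots> \<le> f (tree_matrix T \<xi>)" by (rule H_le[OF l0])
      finally show ?thesis .
    next
      case False
      then have "?u \<xi> = 0" by (intro sum.neutral) auto
      then show ?thesis using nonneg by simp
    qed
    have "(\<Sum>l\<in>Ls. N.prob (c l) * H m l) - \<epsilon> / 3 \<le> (\<Sum>l\<in>Ls. N.prob (c l) * H m l) - W * \<delta>"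
      using W\<delta> by simp
    also have "\<dots> = (\<Sum>l\<in>Ls. N.prob (c l) * H m l - (real m + real m ^ 2) * \<delta> * B)"
      by (simp add: sum_subtractf W_def)
    also have "\<dots> \<le> (\<Sum>l\<in>Ls. Q.prob (C l) * H m l)"
    proof (rule sum_mono)
      fix l assume l: "l \<in> Ls"
      have "(real m + real m ^ 2) * \<delta> * H m l \<le> (real m + real m ^ 2) * \<delta> * B"
        using HB \<delta> by (intro mult_left_mono) auto
      moreover have "(N.prob (c l) - (real m + real m ^ 2) * \<delta>) * H m l \<le> Q.prob (C l) * H m l"
        by (rule mult_right_mono[OF prob_C[OF l] H0])
      ultimately show "N.prob (c l) * H m l - (real m + real m ^ 2) * \<delta> * B \<le> Q.prob (C l) * H m l"
        unfolding left_diff_distrib by linarith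
    qed
    also have "\<dots> = Q.expectation ?u"
      by (rule Q.expectation_indicator_sum(2)[symmetric, OF finLs sets_C])
    also have "\<dots> \<le> Q.expectation (\<lambda>\<xi>. f (tree_matrix T \<xi>))"
    proof (rule integral_mono)
      show "integrable ?Q ?u" by (rule Q.expectation_indicator_sum(1)[OF finLs sets_C])
      show "integrable ?Q (\<lambda>\<xi>. f (tree_matrix T \<xi>))"
      proof (rule Q.integrable_const_bound[of _ B])
        show "AE \<xi> in ?Q. norm (f (tree_matrix T \<xi>)) \<le> B"
          using nonneg bound by (intro AE_I2) simp
        show "(\<lambda>\<xi>. f (tree_matrix T \<xi>)) \<in> borel_measurable ?Q"
          by (rule measurable_compose[OF measurable_tree_matrix f])
      qed
    qed (rule pointwise)
    also have "\<dots> = (\<integral>x. f x \<partial>tau_tree T)"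
      unfolding tau_tree_eq by (rule integral_distr[OF measurable_tree_matrix f, symmetric])
    finally show ?thesis using upper m L unfolding Ups by linarith
  qed
  then show ?thesis
    using \<delta> unfolding g_def by (intro exI[of _ L] exI[of _ \<delta>]) blast
qed

section \<open>From test functions to the weak topology\<close>

lemma tendsto_prob_mono:
  fixes P :: "nat \<Rightarrow> 'a measure"
  assumes P: "eventually (\<lambda>n. prob_space (P n) \<and> sets (P n) = UNIV) F"
    and A: "((\<lambda>n. measure (P n) (A n)) \<longlongrightarrow> 1) F" and sub: "\<And>n. A n \<subseteq> B n"
  shows "((\<lambda>n. measure (P n) (B n)) \<longlongrightarrow> 1) F"
proof (rule tendsto_sandwich[OF _ _ A tendsto_const])
  show "eventually (\<lambda>n. measure (P n) (A n) \<le> measure (P n) (B n)) F"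
    using P
  proof eventually_elim
    case (elim n)
    then interpret prob_space "P n" by simp
    show ?case by (rule finite_measure_mono[OF sub]) (use elim in simp)
  qed
  show "eventually (\<lambda>n. measure (P n) (B n) \<le> 1) F"
    using P by eventually_elim (simp add: prob_space.prob_le_1)
qed

lemma tendsto_prob_Int:
  fixes P :: "nat \<Rightarrow> 'a measure"
  assumes P: "eventually (\<lambda>n. prob_space (P n) \<and> sets (P n) = UNIV) F"
    and A: "((\<lambda>n. measure (P n) (A n)) \<longlongrightarrow> 1) F" and B: "((\<lambda>n. measure (P n) (B n)) \<longlongrightarrow> 1) F"
  shows "((\<lambda>n. measure (P n) (A n \<inter> B n)) \<longlongrightarrow> 1) F"
proof (rule tendsto_sandwich[OF _ _ _ tendsto_const])
  show "((\<lambda>n. measure (P n) (A n) + measure (P n) (B n) - 1) \<longlongrightarrow> 1) F"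
    using tendsto_diff[OF tendsto_add[OF A B] tendsto_const[of 1]] by simp
  show "eventually (\<lambda>n. measure (P n) (A n) + measure (P n) (B n) - 1 \<le> measure (P n) (A n \<inter> B n)) F"
    using P
  proof eventually_elim
    case (elim n)
    then interpret prob_space "P n" by simp
    have "prob (A n) = prob (A n \<inter> B n) + prob (A n - B n)"
      using finite_measure_Union[of "A n \<inter> B n" "A n - B n"] elim by (simp add: Int_Diff_Un Int_Diff_disjoint)
    moreover have "prob (A n - B n) + prob (B n) = prob (A n - B n \<union> B n)"
      by (rule finite_measure_Union[symmetric]) (use elim in auto)
    moreover have "prob (A n - B n \<union> B n) \<le> 1" by (rule prob_le_1)
    ultimately show ?case by linarith
  qed
  show "eventually (\<lambda>n. measure (P n) (A n \<inter> B n) \<le> 1) F"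
    using P by eventually_elim (simp add: prob_space.prob_le_1)
qed

theorem theorem10p1:
  fixes \<zeta> :: "nat pmf" and \<kappa> :: real
  assumes "integrable (measure_pmf \<zeta>) real"
    and "\<kappa> = measure_pmf.expectation \<zeta> real"
    and "0 < \<kappa>" and "\<kappa> < 1"
    and "\<And>R :: real. R > 1 \<Longrightarrow> (\<integral>\<^sup>+k. ennreal (R ^ k) \<partial>measure_pmf \<zeta>) = \<infinity>"
    and "converges_in_prob euclideanreal (conditioned_GW \<zeta>)
           (\<lambda>n T. real (max_outdegree T) / real n) (1 - \<kappa>) (GW_sizes \<zeta>)"
  shows "converges_in_prob weak_topology (conditioned_GW \<zeta>)
           (\<lambda>n T. tau_tree T) (tau_Upsilon (Ge (1 - \<kappa>))) (GW_sizes \<zeta>)"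
proof -
  let ?\<Upsilon> = "tau_Upsilon (Ge (1 - \<kappa>))"
  let ?F = "GW_sizes \<zeta>"
  let ?whp = "\<lambda>A. ((\<lambda>n. measure (conditioned_GW \<zeta> n) (A n)) \<longlongrightarrow> 1) ?F"
  define Nbhd where "Nbhd f V = {\<mu> :: (nat \<Rightarrow> nat \<Rightarrow> real) measure.
      prob_space \<mu> \<and> sets \<mu> = sets borel \<and> (\<integral>x. f x \<partial>\<mu>) \<in> V}" for f and V :: "real set"
  \<comment> \<open>The conditioned law is a probability measure only for sizes of positive
    probability, which is why this holds eventually along \<open>GW_sizes \<zeta>\<close>. All sets
    of trees are measurable for it.\<close>
  have P: "eventually (\<lambda>n. prob_space (conditioned_GW \<zeta> n) \<and> sets (conditioned_GW \<zeta> n) = UNIV) ?F"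
    unfolding eventually_GW_sizes using prob_space_conditioned_GW by simp
  have \<Upsilon>: "prob_space ?\<Upsilon>" "sets ?\<Upsilon> = sets borel"
    by (simp_all add: prob_space_tau_Upsilon_Ge) (simp add: tau_Upsilon_def)
  have \<tau>: "prob_space (tau_tree T)" "sets (tau_tree T) = sets borel" for T
    by (simp_all add: prob_space_tau_tree) (simp add: tau_tree_def)
  have lower: "?whp (\<lambda>_. {T. (\<integral>x. f x \<partial>?\<Upsilon>) - \<epsilon> \<le> (\<integral>x. f x \<partial>tau_tree T)})"
    if cont: "continuous_on UNIV f" and f: "\<And>x. 0 \<le> f x" "\<And>x. f x \<le> B" and \<epsilon>: "0 < \<epsilon>"
    for f :: "(nat \<Rightarrow> nat \<Rightarrow> real) \<Rightarrow> real" and B \<epsilon>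
  proof -
    obtain L \<delta> where \<delta>: "0 < \<delta>" and L: "\<forall>T v. T \<in> range family_tree \<longrightarrow> finite T \<longrightarrow>
        spread_below T v (\<lambda>l. (1 - \<kappa>) * \<kappa> ^ (l - 1)) \<delta> L \<longrightarrow>
        (\<integral>x. f x \<partial>?\<Upsilon>) - \<epsilon> \<le> (\<integral>x. f x \<partial>tau_tree T)"
      using tau_tree_lower_bound[OF assms(3,4) cont f \<epsilon>] by blast
    have "{T \<in> range family_tree. finite T \<and> card T = n \<and>
          (\<exists>v. spread_below T v (\<lambda>l. (1 - \<kappa>) * \<kappa> ^ (l - 1)) \<delta> L)}
        \<subseteq> {T. (\<integral>x. f x \<partial>?\<Upsilon>) - \<epsilon> \<le> (\<integral>x. f x \<partial>tau_tree T)}" for n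
    proof
      fix T
      assume "T \<in> {T \<in> range family_tree. finite T \<and> card T = n \<and>
          (\<exists>v. spread_below T v (\<lambda>l. (1 - \<kappa>) * \<kappa> ^ (l - 1)) \<delta> L)}"
      then obtain v where "T \<in> range family_tree" "finite T"
          "spread_below T v (\<lambda>l. (1 - \<kappa>) * \<kappa> ^ (l - 1)) \<delta> L" by auto
      from L[rule_format, OF this]
      show "T \<in> {T. (\<integral>x. f x \<partial>?\<Upsilon>) - \<epsilon> \<le> (\<integral>x. f x \<partial>tau_tree T)}" by simp
    qed
    from tendsto_prob_mono[OF P conditioned_GW_spread_below[OF assms \<delta>] this] show ?thesis .
  qed
  have basis: "?whp (\<lambda>_. {T. tau_tree T \<in> Nbhd f V})"
    if cont: "continuous_on UNIV f" and bdd: "bounded (range f)" and V: "open V" "(\<integral>x. f x \<partial>?\<Upsilon>) \<in> V"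
    for f :: "(nat \<Rightarrow> nat \<Rightarrow> real) \<Rightarrow> real" and V
  proof -
    obtain \<epsilon> where \<epsilon>: "0 < \<epsilon>" and ball: "ball (\<integral>x. f x \<partial>?\<Upsilon>) \<epsilon> \<subseteq> V"
      using V open_contains_ball by blast
    obtain B where B: "\<And>x. \<bar>f x\<bar> \<le> B"
      using bdd unfolding bounded_iff by auto
    have int: "integrable \<mu> f" if \<mu>: "prob_space \<mu>" "sets \<mu> = sets borel" for \<mu>
    proof -
      interpret prob_space \<mu> by fact
      have "f \<in> borel_measurable \<mu>"
        using borel_measurable_continuous_onI[OF cont] measurable_cong_sets[OF \<mu>(2) refl] by blast
      then show ?thesis using B by (intro integrable_const_bound[of _ B]) auto
    qed
    have shift: "(\<integral>x. B + f x \<partial>\<mu>) = B + (\<integral>x. f x \<partial>\<mu>)" "(\<integral>x. B - f x \<partial>\<mu>) = B - (\<integral>x. f x \<partial>\<mu>)"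
      if \<mu>: "prob_space \<mu>" "sets \<mu> = sets borel" for \<mu>
    proof -
      interpret prob_space \<mu> by fact
      show "(\<integral>x. B + f x \<partial>\<mu>) = B + (\<integral>x. f x \<partial>\<mu>)" "(\<integral>x. B - f x \<partial>\<mu>) = B - (\<integral>x. f x \<partial>\<mu>)"
        using int[OF \<mu>] by (simp_all add: prob_space)
    qed
    have bounds: "0 \<le> B + f x" "B + f x \<le> 2 * B" "0 \<le> B - f x" "B - f x \<le> 2 * B" for x
      using B[of x] by linarith+
    have \<epsilon>2: "0 < \<epsilon> / 2" using \<epsilon> by simp
    have "continuous_on UNIV (\<lambda>x. B + f x)" "continuous_on UNIV (\<lambda>x. B - f x)"
      using cont by (auto intro!: continuous_intros)
    \<comment> \<open>The two bounds confine the integral of \<open>f\<close> from below and from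
      above. Using half of \<epsilon> turns the weak inequalities into membership in the open
      ball.\<close>
    from tendsto_prob_Int[OF P lower[OF this(1) bounds(1,2) \<epsilon>2] lower[OF this(2) bounds(3,4) \<epsilon>2]]
    show ?thesis
    proof (rule tendsto_prob_mono[OF P], intro subsetI)
      fix T assume "T \<in> {T. (\<integral>x. B + f x \<partial>?\<Upsilon>) - \<epsilon> / 2 \<le> (\<integral>x. B + f x \<partial>tau_tree T)} \<inter>
          {T. (\<integral>x. B - f x \<partial>?\<Upsilon>) - \<epsilon> / 2 \<le> (\<integral>x. B - f x \<partial>tau_tree T)}"
      then have "(\<integral>x. f x \<partial>tau_tree T) \<in> ball (\<integral>x. f x \<partial>?\<Upsilon>) \<epsilon>"
        unfolding shift[OF \<Upsilon>] shift[OF \<tau>] using \<epsilon> by (auto simp: dist_real_def)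
      then show "T \<in> {T. tau_tree T \<in> Nbhd f V}"
        using ball \<tau> by (auto simp: Nbhd_def)
    qed
  qed
  have weak: "weak_topology = topology_generated_by {Nbhd f V | f V. continuous_on UNIV f \<and> bounded (range f) \<and> open V}"
    unfolding weak_topology_def Nbhd_def ..
  have "?whp (\<lambda>_. {T. tau_tree T \<in> U})" if U: "openin weak_topology U" "?\<Upsilon> \<in> U" for U
  proof -
    have "generate_topology_on {Nbhd f V | f V. continuous_on UNIV f \<and> bounded (range f) \<and> open V} U"
      using U(1) unfolding weak openin_topology_generated_by_iff .
    \<comment> \<open>Induction over the generation of the open set: intersections are binary, so
      two events of probability tending to 1 are intersected; in a union, one member containing the
      limit suffices.\<close>
    then show ?thesis using U(2)
    proof induction
      case (Int a b)
      then have "?\<Upsilon> \<in> a" "?\<Upsilon> \<in> b" by auto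
      from tendsto_prob_Int[OF P Int.IH(1)[OF this(1)] Int.IH(2)[OF this(2)]]
      show ?case by (rule tendsto_prob_mono[OF P]) blast
    next
      case (UN K)
      then obtain k where k: "k \<in> K" "?\<Upsilon> \<in> k" by blast
      show ?case by (rule tendsto_prob_mono[OF P UN.IH[OF k]]) (use k in blast)
    next
      case (Basis s)
      then obtain f V where s: "s = Nbhd f V" and f: "continuous_on UNIV f" "bounded (range f)" "open V" by blast
      have "(\<integral>x. f x \<partial>?\<Upsilon>) \<in> V" using Basis.prems unfolding s Nbhd_def by blast
      from basis[OF f this] show ?case unfolding s .
    qed simp
  qed
  moreover have "?\<Upsilon> \<in> topspace weak_topology"
  proof -
    \<comment> \<open>This subbasic set imposes no condition on the integral, so it consists of all
      Borel probability measures.\<close>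
    have "Nbhd (\<lambda>_. 0) UNIV \<in> {Nbhd f V | f V. continuous_on UNIV f \<and> bounded (range f) \<and> open V}"
      by (intro CollectI exI[of _ "\<lambda>_. 0"] exI[of _ UNIV]) auto
    moreover have "?\<Upsilon> \<in> Nbhd (\<lambda>_. 0) UNIV" using \<Upsilon> by (simp add: Nbhd_def)
    ultimately show ?thesis unfolding weak topology_generated_by_topspace by blast
  qed
  ultimately show ?thesis
    unfolding converges_in_prob_def by simp
qed

end
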